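(* Let $\mathbb{X}\subseteq\mathbb{P}^2$ be a $\Bbbk$-configuration of type $(1,2,\dots,s)$ with $s\ge2$, and assume there are exactly $s$ lines in $\mathbb{P}^2$ containing $s$ points of $\mathbb{X}$. Then $\Delta\mathbf{H}_{m\mathbb{X}}(ms-1)=s$ for all integers $m\ge2$.
   Context: $\Bbbk$ is an algebraically closed field and $R=\Bbbk[x_0,x_1,x_2]$. A $\Bbbk$-configuration of type $(d_1,\dots,d_s)$ is a finite set $\mathbb{X}\subseteq\mathbb{P}^2$ for which there exist integers $1\le d_1<\cdots<d_s$, subsets $\mathbb{X}_1,\dots,\mathbb{X}_s$ of $\mathbb{X}$ and distinct lines $\mathbb{L}_1,\dots,\mathbb{L}_s\subseteq\mathbb{P}^2$ such that (1) $\mathbb{X}=\bigcup_{i=1}^s\mathbb{X}_i$; (2) $|\mathbb{X}_i|=d_i$ and $\mathbb{X}_i\subseteq\mathbb{L}_i$ for each $i$; (3) for $1<i\le s$, $\mathbb{L}_i$ contains no point of $\mathbb{X}_j$ for any $j<i$. For $\mathbb{X}=\{P_1,\dots,P_n\}$ and $m\ge1$, $m\mathbb{X}$ is the fat point scheme with ideal $I_{m\mathbb{X}}=I_{P_1}^m\cap\cdots\cap I_{P_n}^m$, where $I_P$ is the ideal of $P$. $\mathbf{H}_\mathbb{Z}(t)=\dim_\Bbbk R_t-\dim_\Bbbk(I_\mathbb{Z})_t$ and $\Delta\mathbf{H}_\mathbb{Z}(t)=\mathbf{H}_\mathbb{Z}(t)-\mathbf{H}_\mathbb{Z}(t-1)$,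 with $\mathbf{H}_\mathbb{Z}(t)=0$ for $t<0$. *)

theory Defs
  imports Main "HOL-Library.Poly_Mapping" "HOL-Library.Numeral_Type"
    "HOL-Computational_Algebra.Polynomial"
begin

definition alg_closed :: "'k::field itself \<Rightarrow> bool" where
  "alg_closed _ \<longleftrightarrow> (\<forall>p::'k poly. degree p \<ge> 1 \<longrightarrow> (\<exists>x. poly p x = 0))"

text \<open>R = k[x0,x1,x2]: polynomials in three variables (indexed by the type 3),
  monomials are finitely supported exponent maps 3 \<Rightarrow> nat.\<close>
type_synonym 'k mpoly3 = "(3 \<Rightarrow>\<^sub>0 nat) \<Rightarrow>\<^sub>0 'k"

definition mdeg :: "(3 \<Rightarrow>\<^sub>0 nat) \<Rightarrow> nat" where
  "mdeg \<mu> = (\<Sum>i\<in>UNIV. Poly_Mapping.lookup \<mu> i)"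

definition homog :: "'k::field mpoly3 \<Rightarrow> nat \<Rightarrow> bool" where
  "homog F t \<longleftrightarrow> (\<forall>\<mu>\<in>Poly_Mapping.keys F. mdeg \<mu> = t)"

definition eval3 :: "'k::field mpoly3 \<Rightarrow> (3 \<Rightarrow> 'k) \<Rightarrow> 'k" where
  "eval3 F v = (\<Sum>\<mu>\<in>Poly_Mapping.keys F. Poly_Mapping.lookup F \<mu> * (\<Prod>i\<in>UNIV. v i ^ Poly_Mapping.lookup \<mu> i))"

definition pscale :: "'k::field \<Rightarrow> 'k mpoly3 \<Rightarrow> 'k mpoly3" where
  "pscale c F = Poly_Mapping.single 0 c * F"

definition deg_part :: "'k::field mpoly3 set \<Rightarrow> nat \<Rightarrow> 'k mpoly3 set" where
  "deg_part I t = {F \<in> I. homog F t}"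

definition ideal_gen :: "'k::field mpoly3 set \<Rightarrow> 'k mpoly3 set" where
  "ideal_gen S = {F. \<exists>A g. finite A \<and> A \<subseteq> S \<and> F = (\<Sum>a\<in>A. g a * a)}"

definition proj_pt :: "(3 \<Rightarrow> 'k::field) \<Rightarrow> (3 \<Rightarrow> 'k) set" where
  "proj_pt v = {(\<lambda>i. c * v i) | c. c \<noteq> 0}"

definition P2 :: "(3 \<Rightarrow> 'k::field) set set" where
  "P2 = {proj_pt v | v. v \<noteq> (\<lambda>_. 0)}"

definition proj_line :: "(3 \<Rightarrow> 'k::field) \<Rightarrow> (3 \<Rightarrow> 'k) set set" where
  "proj_line a = {P \<in> P2. \<forall>v\<in>P. (\<Sum>i\<in>UNIV. a i * v i) = 0}"

definition is_line :: "(3 \<Rightarrow> 'k::field) set set \<Rightarrow> bool" where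
  "is_line L \<longleftrightarrow> (\<exists>a. a \<noteq> (\<lambda>_. 0) \<and> L = proj_line a)"

text \<open>I_P: ideal generated by linear forms vanishing at P; I_P^m: ideal generated by
  products of m such generators; I_{mX} = intersection of the I_P^m.\<close>
definition pt_ideal_pow :: "(3 \<Rightarrow> 'k::field) set \<Rightarrow> nat \<Rightarrow> 'k mpoly3 set" where
  "pt_ideal_pow P m = ideal_gen {prod_list Ls | Ls. length Ls = m \<and>
      (\<forall>L\<in>set Ls. homog L 1 \<and> (\<forall>v\<in>P. eval3 L v = 0))}"

definition fat_ideal :: "(3 \<Rightarrow> 'k::field) set set \<Rightarrow> nat \<Rightarrow> 'k mpoly3 set" where
  "fat_ideal X m = {F. \<forall>P\<in>X. F \<in> pt_ideal_pow P m}"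

definition hilb_fat :: "(3 \<Rightarrow> 'k::field) set set \<Rightarrow> nat \<Rightarrow> int \<Rightarrow> int" where
  "hilb_fat X m t = (if t < 0 then 0 else
     int (vector_space.dim (pscale :: 'k \<Rightarrow> _) (deg_part UNIV (nat t)))
     - int (vector_space.dim (pscale :: 'k \<Rightarrow> _) (deg_part (fat_ideal X m) (nat t))))"

definition delta_hilb_fat :: "(3 \<Rightarrow> 'k::field) set set \<Rightarrow> nat \<Rightarrow> int \<Rightarrow> int" where
  "delta_hilb_fat X m t = hilb_fat X m t - hilb_fat X m (t - 1)"

definition kconfig :: "(3 \<Rightarrow> 'k::field) set set \<Rightarrow> (nat \<Rightarrow> nat) \<Rightarrow> nat \<Rightarrow> bool" where
  "kconfig X d s \<longleftrightarrow> X \<subseteq> P2 \<and> finite X \<and> 1 \<le> d 1 \<and>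
     (\<forall>i\<in>{1..s}. \<forall>j\<in>{1..s}. i < j \<longrightarrow> d i < d j) \<and>
     (\<exists>Xs Ls. X = (\<Union>i\<in>{1..s}. Xs i) \<and>
        (\<forall>i\<in>{1..s}. is_line (Ls i)) \<and> inj_on Ls {1..s} \<and>
        (\<forall>i\<in>{1..s}. Xs i \<subseteq> X \<and> card (Xs i) = d i \<and> Xs i \<subseteq> Ls i) \<and>
        (\<forall>i\<in>{1..s}. \<forall>j\<in>{1..s}. j < i \<longrightarrow> Ls i \<inter> Xs j = {}))"

end

theory Submission
  imports Defs
begin

text \<open>Counting incidences shows that the \<open>s\<close> lines meet pairwise in points of \<open>X\<close>, no three of them
  in the same point, and that each of them contains exactly one further point of \<open>X\<close>; these \<open>s\<close>
  further points are not collinear, as there is no other line with \<open>s\<close> points.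
  By Bezout, a form of degree \<open>t < m s\<close> in the ideal of \<open>m X\<close> is divisible by the product of the
  \<open>s\<close> lines, and the quotient has degree \<open>t - s\<close> and multiplicity \<open>m - r\<close> at a point on \<open>r\<close> of the lines.
  These residual forms of degree \<open>d = (m - 1) s - 1\<close> restrict onto all forms of degree \<open>d\<close> on a
  general line: peel off the lines one at a time, until only the further points remain, each with
  multiplicity one, and use that these are not collinear. Hence passing from degree \<open>d - 1\<close> to \<open>d\<close> the
  dimension of the residual ideal grows by \<open>d + 1 = (m - 1) s\<close>, while that of the whole ring grows by
  \<open>m s\<close> in the corresponding degree \<open>m s - 1\<close>.\<close>

text \<open>The degree bounds leave no slack, and this shapes the peeling. To peel a line
  \<open>k\<close> one needs a form of the current degree with the prescribed multiplicities that
  does not vanish where \<open>k\<close> meets the general line, so \<open>k\<close> cannot be a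
  factor of it. At the intersection points the other lines supply enough multiplicity. The further
  point on \<open>k\<close> needs a replacement line, and sending that line through the further
  point of a second line as well saves the one degree that would otherwise be missing. At the end,
  \<open>s\<close> simple points have to be handled in degree \<open>s - 1\<close>. If they were
  collinear, every form of that degree through them would contain their line and hence vanish where
  it meets the general line, so restriction would not be onto. This is why the number of lines with
  \<open>s\<close> points must be exactly \<open>s\<close>. Algebraic closure enters through the
  infinitude of the field, which provides the general line.\<close>

text \<open>Needed for the library's integral domain instance to apply to polynomials in three variables.\<close>

instance poly_mapping :: (linorder, "{ordered_comm_monoid_add, ordered_ab_semigroup_add_imp_le, cancel_comm_monoid_add, linorder}") ordered_cancel_comm_monoid_add ..

lemma cases_3: "x = 0 \<or> x = 1 \<or> x = (2 :: 3)"
proof (induct x)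
  case (of_int z)
  then have "z = 0 \<or> z = 1 \<or> z = 2" by fastforce
  then show ?case by auto
qed

lemma UNIV_3: "(UNIV :: 3 set) = {0, 1, 2}"
proof (rule set_eqI)
  show "x \<in> UNIV \<longleftrightarrow> x \<in> {0, 1, 2}" for x :: 3
    using cases_3[of x] by simp
qed

lemma sum_3: "(\<Sum>i\<in>UNIV. f (i :: 3)) = f 0 + f 1 + f 2"
  unfolding UNIV_3 by (simp add: ac_simps)

lemma prod_3: "(\<Prod>i\<in>UNIV. f (i :: 3)) = f 0 * f 1 * f 2"
  unfolding UNIV_3 by (simp add: ac_simps)

lemma all_3: "(\<forall>i :: 3. P i) \<longleftrightarrow> P 0 \<and> P 1 \<and> P 2"
proof (intro iffI allI)
  fix i :: 3
  assume "P 0 \<and> P 1 \<and> P 2"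
  then show "P i" using cases_3[of i] by auto
qed simp

lemma poly_mapping_add_single_induct [case_names zero add]:
  assumes "P 0" "\<And>f a b. P f \<Longrightarrow> P (f + Poly_Mapping.single a b)"
  shows "P f"
proof (induction f rule: update_induct)
  case const
  show ?case by (rule assms(1))
next
  case (update f a b)
  have "Poly_Mapping.update a b f = f + Poly_Mapping.single a b"
    by (rule poly_mapping_eqI)
      (use update in \<open>auto simp: lookup_update lookup_add lookup_single in_keys_iff\<close>)
  then show ?case using assms(2) update by simp
qed

subsection \<open>Substitution homomorphisms\<close>

definition ring_hom :: "('a::comm_ring_1 \<Rightarrow> 'b::comm_ring_1) \<Rightarrow> bool" where
  "ring_hom h \<longleftrightarrow> h 1 = 1 \<and> (\<forall>x y. h (x + y) = h x + h y) \<and> (\<forall>x y. h (x * y) = h x * h y)"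

lemma ring_hom_simps:
  assumes "ring_hom h"
  shows "h 0 = 0" "h 1 = 1" "h (x + y) = h x + h y" "h (x * y) = h x * h y"
    "h (- x) = - h x" "h (x - y) = h x - h y" "h (x ^ n) = h x ^ n"
proof -
  show one: "h 1 = 1" and plus: "h (x + y) = h x + h y" and times: "h (x * y) = h x * h y" for x y
    using assms by (auto simp: ring_hom_def)
  show zero: "h 0 = 0" using plus[of 0 0] by simp
  show minus: "h (- x) = - h x" for x
    using plus[of x "- x"] zero by (simp add: eq_neg_iff_add_eq_0 add.commute)
  show "h (x - y) = h x - h y" using plus[of x "- y"] minus[of y] by simp
  show "h (x ^ n) = h x ^ n" by (induction n) (auto simp: one times)
qed

lemma ring_hom_sum:
  assumes "ring_hom h" shows "h (sum f A) = (\<Sum>x\<in>A. h (f x))"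
  by (induction A rule: infinite_finite_induct) (auto simp: ring_hom_simps[OF assms])

lemma ring_hom_prod:
  assumes "ring_hom h" shows "h (prod f A) = (\<Prod>x\<in>A. h (f x))"
  by (induction A rule: infinite_finite_induct) (auto simp: ring_hom_simps[OF assms])

text \<open>The universal homomorphism out of the polynomial ring: \<open>h\<close> acts on
  coefficients and \<open>g\<close> gives the images of the variables. Evaluation, grading,
  expansion at a point and restriction to a line are all instances.\<close>

definition subst3 :: "('k::field \<Rightarrow> 'b::comm_ring_1) \<Rightarrow> (3 \<Rightarrow> 'b) \<Rightarrow> 'k mpoly3 \<Rightarrow> 'b" where
  "subst3 h g F = (\<Sum>\<mu>\<in>Poly_Mapping.keys F. h (Poly_Mapping.lookup F \<mu>) *
     (\<Prod>i\<in>UNIV. g i ^ Poly_Mapping.lookup \<mu> i))"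

lemma ring_hom_id: "ring_hom (\<lambda>x. x)"
  by (simp add: ring_hom_def)

lemma eval3_eq_subst3: "eval3 F v = subst3 (\<lambda>c. c) v F"
  by (simp add: eval3_def subst3_def)

text \<open>The support of a sum can shrink by cancellation; a common superset of the supports makes
  additivity a termwise matter.\<close>

lemma subst3_superset:
  assumes "h 0 = 0" "finite A" "Poly_Mapping.keys F \<subseteq> A"
  shows "subst3 h g F = (\<Sum>\<mu>\<in>A. h (Poly_Mapping.lookup F \<mu>) * (\<Prod>i\<in>UNIV. g i ^ Poly_Mapping.lookup \<mu> i))"
  unfolding subst3_def
  by (rule sum.mono_neutral_left) (use assms in \<open>auto simp: in_keys_iff\<close>)

lemma subst3_single:
  assumes "h 0 = 0"
  shows "subst3 h g (Poly_Mapping.single \<mu> c) = h c * (\<Prod>i\<in>UNIV. g i ^ Poly_Mapping.lookup \<mu> i)"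
  using assms by (simp add: subst3_def)

lemma subst3_add:
  assumes "ring_hom h"
  shows "subst3 h g (F + G) = subst3 h g F + subst3 h g G"
proof -
  let ?A = "Poly_Mapping.keys F \<union> Poly_Mapping.keys G"
  have sub: "Poly_Mapping.keys (F + G) \<subseteq> ?A"
    by (rule Poly_Mapping.keys_add)
  show ?thesis
    using sub by (simp add: subst3_superset[of h ?A] ring_hom_simps[OF assms] lookup_add
        distrib_right sum.distrib)
qed

lemma subst3_mult:
  assumes "ring_hom h"
  shows "subst3 h g (F * G) = subst3 h g F * subst3 h g G"
proof (induction F rule: poly_mapping_add_single_induct)
  case zero
  then show ?case by (simp add: subst3_def)
next
  case (add F a b)
  have "subst3 h g (Poly_Mapping.single a b * G) = subst3 h g (Poly_Mapping.single a b) * subst3 h g G"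
  proof (induction G rule: poly_mapping_add_single_induct)
    case zero
    then show ?case by (simp add: subst3_def)
  next
    case (add G c d)
    then show ?case
      by (simp add: distrib_left subst3_add[OF assms] mult_single subst3_single
          ring_hom_simps[OF assms] lookup_add power_add prod.distrib ac_simps)
  qed
  then show ?case using add by (simp add: distrib_right subst3_add[OF assms])
qed

lemma ring_hom_subst3:
  assumes "ring_hom h" shows "ring_hom (subst3 h g)"
  using subst3_mult[OF assms] subst3_add[OF assms]
  by (auto simp: ring_hom_def subst3_single ring_hom_simps[OF assms] simp flip: single_one)

lemma subst3_hom:
  assumes "ring_hom h" "ring_hom f"
  shows "f (subst3 h g F) = subst3 (\<lambda>c. f (h c)) (\<lambda>i. f (g i)) F"
  by (simp add: subst3_def ring_hom_sum[OF assms(2)] ring_hom_prod[OF assms(2)] ring_hom_simps[OF assms(2)])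

abbreviation C3 :: "'k::field \<Rightarrow> 'k mpoly3" where
  "C3 c \<equiv> Poly_Mapping.single 0 c"

definition X3 :: "3 \<Rightarrow> 'k::field mpoly3" where
  "X3 i = Poly_Mapping.single (Poly_Mapping.single i 1) 1"

lemma ring_hom_C3: "ring_hom C3"
  by (auto simp: ring_hom_def single_add mult_single)

lemma ring_hom_const_poly: 
  assumes "ring_hom h" shows "ring_hom (\<lambda>x. [:h x:])"
  by (auto simp: ring_hom_def ring_hom_simps[OF assms])

lemma ring_hom_poly: "ring_hom (\<lambda>p. poly p x)"
  by (auto simp: ring_hom_def)

lemma X3_power: "X3 i ^ n = Poly_Mapping.single (Poly_Mapping.single i n) 1"
  by (induction n) (auto simp: X3_def mult_single single_add[symmetric])

lemma poly_mapping_3: "\<mu> = Poly_Mapping.single (0::3) (Poly_Mapping.lookup \<mu> 0) +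
    Poly_Mapping.single 1 (Poly_Mapping.lookup \<mu> 1) + Poly_Mapping.single 2 (Poly_Mapping.lookup \<mu> 2)"
proof (rule poly_mapping_eqI)
  fix k :: 3
  show "Poly_Mapping.lookup \<mu> k = Poly_Mapping.lookup (Poly_Mapping.single (0::3) (Poly_Mapping.lookup \<mu> 0) +
    Poly_Mapping.single 1 (Poly_Mapping.lookup \<mu> 1) + Poly_Mapping.single 2 (Poly_Mapping.lookup \<mu> 2)) k"
    using cases_3[of k] by (auto simp: lookup_add lookup_single when_def)
qed

lemma C3_prod_X3: "C3 c * (\<Prod>i\<in>UNIV. X3 i ^ Poly_Mapping.lookup \<mu> i) = Poly_Mapping.single \<mu> c"
proof -
  have "C3 c * (\<Prod>i\<in>UNIV. X3 i ^ Poly_Mapping.lookup \<mu> i) =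
    Poly_Mapping.single (Poly_Mapping.single (0::3) (Poly_Mapping.lookup \<mu> 0) +
    Poly_Mapping.single 1 (Poly_Mapping.lookup \<mu> 1) + Poly_Mapping.single 2 (Poly_Mapping.lookup \<mu> 2)) c"
    by (simp add: prod_3 X3_power mult_single add.assoc)
  then show ?thesis by (simp only: poly_mapping_3[symmetric])
qed

lemma mpoly3_induct [case_names C3 X3 add mult]:
  assumes "\<And>c. P (C3 c)" "\<And>i. P (X3 i)"
    "\<And>F G. P F \<Longrightarrow> P G \<Longrightarrow> P (F + G)" "\<And>F G. P F \<Longrightarrow> P G \<Longrightarrow> P (F * G)"
  shows "P (F :: 'k::field mpoly3)"
proof (induction F rule: poly_mapping_add_single_induct)
  case zero
  then show ?case using assms(1)[of 0] by simp
next
  case (add f a b)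
  have 1: "P 1" using assms(1)[of 1] by simp
  have pow: "P (X3 i ^ n)" for i n
    by (induction n) (use 1 assms in auto)
  have "P (C3 b * (\<Prod>i\<in>UNIV. X3 i ^ Poly_Mapping.lookup a i))"
    unfolding prod_3 by (intro assms pow)
  then show ?case using add assms(3) unfolding C3_prod_X3 by blast
qed

lemma subst3_C3: "ring_hom h \<Longrightarrow> subst3 h g (C3 c) = h c"
  by (simp add: subst3_single ring_hom_simps)

lemma subst3_X3: "ring_hom h \<Longrightarrow> subst3 h g (X3 i) = g i"
  using cases_3[of i] unfolding X3_def
  by (auto simp add: subst3_single ring_hom_simps prod_3 lookup_single)

lemma subst3_ident: "subst3 C3 X3 F = F"
  by (induction F rule: mpoly3_induct)
    (auto simp: subst3_C3 subst3_X3 ring_hom_C3 subst3_add subst3_mult)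

subsection \<open>Linear forms and the grading\<close>

definition dot :: "(3 \<Rightarrow> 'a::comm_ring_1) \<Rightarrow> (3 \<Rightarrow> 'a) \<Rightarrow> 'a" where
  "dot a b = (\<Sum>i\<in>UNIV. a i * b i)"

definition cross :: "(3 \<Rightarrow> 'a::comm_ring_1) \<Rightarrow> (3 \<Rightarrow> 'a) \<Rightarrow> 3 \<Rightarrow> 'a" where
  "cross a b i = (if i = 0 then a 1 * b 2 - a 2 * b 1
     else if i = 1 then a 2 * b 0 - a 0 * b 2 else a 0 * b 1 - a 1 * b 0)"

definition Lin :: "(3 \<Rightarrow> 'k::field) \<Rightarrow> 'k mpoly3" where
  "Lin a = (\<Sum>i\<in>UNIV. C3 (a i) * X3 i)"

lemma subst3_Lin:
  assumes "ring_hom h" shows "subst3 h g (Lin a) = (\<Sum>i\<in>UNIV. h (a i) * g i)"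
  unfolding Lin_def sum_3 by (simp add: assms subst3_add subst3_mult subst3_C3 subst3_X3)

lemma single_1_eq_iff: "Poly_Mapping.single (i::3) (1::nat) = Poly_Mapping.single j 1 \<longleftrightarrow> i = j"
  by (metis lookup_single_eq lookup_single_not_eq zero_neq_one)

lemma lookup_Lin: "Poly_Mapping.lookup (Lin a) (Poly_Mapping.single i 1) = a i"
proof -
  have "Poly_Mapping.lookup (Lin a) (Poly_Mapping.single i 1) =
     (\<Sum>j\<in>UNIV. if j = i then a j else 0)"
    unfolding Lin_def lookup_sum
    by (rule sum.cong) (auto simp: X3_def mult_single lookup_single when_def single_1_eq_iff[simplified])
  then show ?thesis by simp
qed

lemma Lin_eq_0_iff: "Lin a = 0 \<longleftrightarrow> a = (\<lambda>_. 0)"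
proof
  assume "Lin a = 0"
  then show "a = (\<lambda>_. 0)" using lookup_Lin[of a] by (auto simp: fun_eq_iff)
qed (simp add: Lin_def)

lemma eval3_Lin: "eval3 (Lin a) v = dot a v"
  by (simp add: eval3_eq_subst3 subst3_Lin ring_hom_id dot_def)

text \<open>Sends \<open>x_i\<close> to \<open>x_i T\<close>, so that the coefficient of
  \<open>T^t\<close> is the component of degree \<open>t\<close>. Homogeneity becomes the equation
  \<open>grade F = monom F t\<close>, and its behaviour under ring operations follows from the
  homomorphism.\<close>

definition grade :: "'k::field mpoly3 \<Rightarrow> 'k mpoly3 poly" where
  "grade F = subst3 (\<lambda>c. [:C3 c:]) (\<lambda>i. monom (X3 i) 1) F"

lemma grade_add: "grade (F + G) = grade F + grade G"
  and grade_mult: "grade (F * G) = grade F * grade G"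
  and grade_C3: "grade (C3 c) = [:C3 c:]"
  and grade_X3: "grade (X3 i) = monom (X3 i) 1"
  by (simp_all add: grade_def subst3_add subst3_mult subst3_C3 subst3_X3 ring_hom_const_poly ring_hom_C3)

lemma grade_0: "grade 0 = 0" and grade_1: "grade 1 = 1"
  using grade_C3[of 0] grade_C3[of 1] by (simp_all add: one_pCons)

lemma grade_single: "grade (Poly_Mapping.single \<mu> c) = monom (Poly_Mapping.single \<mu> c) (mdeg \<mu>)"
proof -
  have pow: "grade (X3 i ^ n) = monom (X3 i ^ n) n" for i n
  proof (induction n)
    case 0
    then show ?case by (simp add: grade_1)
  next
    case (Suc n)
    then show ?case by (simp add: grade_mult grade_X3 mult_monom)
  qed
  have "grade (C3 c * (\<Prod>i\<in>UNIV. X3 i ^ Poly_Mapping.lookup \<mu> i)) =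
    monom (C3 c * (\<Prod>i\<in>UNIV. X3 i ^ Poly_Mapping.lookup \<mu> i)) (mdeg \<mu>)"
    unfolding mdeg_def prod_3 sum_3 grade_mult pow grade_C3
    by (simp add: mult_monom smult_monom mult.assoc)
  then show ?thesis by (simp only: C3_prod_X3)
qed

lemma lookup_coeff_grade:
  "Poly_Mapping.lookup (coeff (grade F) t) \<mu> = (if mdeg \<mu> = t then Poly_Mapping.lookup F \<mu> else 0)"
proof (induction F rule: poly_mapping_add_single_induct)
  case zero
  then show ?case by (simp add: grade_0)
next
  case (add F a b)
  then show ?case
    by (auto simp: grade_add grade_single lookup_add lookup_single when_def)
qed

lemma homog_iff_grade: "homog F t \<longleftrightarrow> grade F = monom F t"
proof
  assume "homog F t"
  then show "grade F = monom F t"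
    by (intro poly_eqI poly_mapping_eqI)
       (auto simp: lookup_coeff_grade homog_def in_keys_iff)
next
  assume *: "grade F = monom F t"
  show "homog F t"
    unfolding homog_def
  proof
    fix \<mu> assume "\<mu> \<in> Poly_Mapping.keys F"
    moreover have "Poly_Mapping.lookup (coeff (grade F) t) \<mu> = Poly_Mapping.lookup F \<mu>"
      by (simp add: *)
    ultimately show "mdeg \<mu> = t"
      by (auto simp: lookup_coeff_grade in_keys_iff split: if_splits)
  qed
qed

lemma homog_zero: "homog 0 t"
  by (simp add: homog_def)

lemma homog_one: "homog 1 0"
  by (simp add: homog_iff_grade grade_1)

lemma homog_add: "homog F t \<Longrightarrow> homog G t \<Longrightarrow> homog (F + G) t"
  by (simp add: homog_iff_grade grade_add add_monom)

lemma homog_mult: "homog F s \<Longrightarrow> homog G t \<Longrightarrow> homog (F * G) (s + t)"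
  by (simp add: homog_iff_grade grade_mult mult_monom)

lemma homog_C3: "homog (C3 c) 0"
  by (simp add: homog_iff_grade grade_C3 monom_0)

lemma homog_C3_mult: "homog F t \<Longrightarrow> homog (C3 c * F) t"
  using homog_mult[OF homog_C3] by fastforce

lemma homog_diff:
  assumes "homog F t" "homog G t" shows "homog (F - G) t"
proof -
  have "F - G = F + C3 (-1) * G" by (simp add: single_uminus)
  then show ?thesis using homog_add[OF assms(1) homog_C3_mult[OF assms(2), of "-1"]] by (simp only:)
qed

lemma homog_sum: "(\<And>x. x \<in> A \<Longrightarrow> homog (f x) t) \<Longrightarrow> homog (sum f A) t"
  by (induction A rule: infinite_finite_induct) (auto intro: homog_zero homog_add)

lemma homog_X3: "homog (X3 i) 1"
  by (simp add: homog_iff_grade grade_X3)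

lemma homog_Lin: "homog (Lin a) 1"
  unfolding Lin_def by (intro homog_sum homog_C3_mult homog_X3)

lemma homog_prod_Lin: "homog (prod_list (map Lin as)) (length as)"
  by (induction as) (use homog_one homog_mult[OF homog_Lin] in auto)

lemma homog_1_imp_Lin:
  assumes "homog L 1" shows "\<exists>a. L = Lin a"
proof
  show "L = Lin (\<lambda>i. Poly_Mapping.lookup L (Poly_Mapping.single i 1))" (is "_ = Lin ?a")
  proof (rule poly_mapping_eqI)
    fix \<mu> :: "3 \<Rightarrow>\<^sub>0 nat"
    show "Poly_Mapping.lookup L \<mu> = Poly_Mapping.lookup (Lin ?a) \<mu>"
    proof (cases "mdeg \<mu> = 1")
      case True
      then have "\<exists>i. \<mu> = Poly_Mapping.single i 1"
        using poly_mapping_3[of \<mu>] unfolding mdeg_def sum_3 by (auto simp: add_is_1)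
      then show ?thesis using lookup_Lin[of ?a] by auto
    next
      case False
      then show ?thesis using assms homog_Lin[of ?a] by (metis homog_def in_keys_iff)
    qed
  qed
qed

text \<open>Cancellation of \<open>Lin a\<close> in the domain of one-variable polynomials over the
  ring.\<close>

lemma homog_Lin_mult_imp:
  assumes "homog (Lin a * H) (Suc t)" "a \<noteq> (\<lambda>_. 0)"
  shows "homog H t"
proof -
  have "monom (Lin a) 1 * grade H = monom (Lin a) 1 * monom H t"
    using assms(1) homog_Lin[of a] by (simp add: homog_iff_grade grade_mult mult_monom)
  moreover have "monom (Lin a) 1 \<noteq> 0"
    using assms(2) by (simp add: Lin_eq_0_iff)
  ultimately show ?thesis
    unfolding homog_iff_grade using mult_left_cancel by blast
qed

lemma homog_coeff_grade: "homog (coeff (grade F) t) t"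
  by (auto simp: homog_def in_keys_iff lookup_coeff_grade split: if_splits)

lemma coeff_grade_Lin_mult: "coeff (grade (Lin a * H)) (Suc t) = Lin a * coeff (grade H) t"
  using homog_Lin[of a] by (simp add: homog_iff_grade grade_mult coeff_monom_mult)

lemma subst3_homog_scale:
  assumes "homog F d"
  shows "subst3 h (\<lambda>i. c * g i) F = c ^ d * subst3 h g F"
  unfolding subst3_def sum_distrib_left
proof (rule sum.cong)
  fix \<mu> assume "\<mu> \<in> Poly_Mapping.keys F"
  then have "d = mdeg \<mu>" using assms by (simp add: homog_def)
  then show "h (Poly_Mapping.lookup F \<mu>) * (\<Prod>i\<in>UNIV. (c * g i) ^ Poly_Mapping.lookup \<mu> i) =
         c ^ d * (h (Poly_Mapping.lookup F \<mu>) * (\<Prod>i\<in>UNIV. g i ^ Poly_Mapping.lookup \<mu> i))"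
    by (simp add: mdeg_def prod_3 sum_3 power_mult_distrib power_add ac_simps)
qed simp

lemma degree_subst3_le:
  assumes "homog F d" "\<And>i. degree (g i) \<le> 1"
  shows "degree (subst3 (\<lambda>c. [:h c:]) g F) \<le> d"
  unfolding subst3_def
proof (rule degree_sum_le)
  fix \<mu> assume "\<mu> \<in> Poly_Mapping.keys F"
  then have d: "d = mdeg \<mu>" using assms by (simp add: homog_def)
  have pow: "degree (g i ^ n) \<le> n" for i n
    using order.trans[OF degree_power_le mult_le_mono1[OF assms(2)]] by simp
  have "degree (\<Prod>i\<in>UNIV. g i ^ Poly_Mapping.lookup \<mu> i) \<le> mdeg \<mu>"
    unfolding prod_3 mdeg_def sum_3 by (intro order.trans[OF degree_mult_le] add_mono pow)
  then show "degree ([:h (Poly_Mapping.lookup F \<mu>):] * (\<Prod>i\<in>UNIV. g i ^ Poly_Mapping.lookup \<mu> i)) \<le> d"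
    by (intro order.trans[OF degree_mult_le]) (simp add: d)
qed simp

subsection \<open>Powers of the ideal of a point\<close>

abbreviation J :: "(3 \<Rightarrow> 'k::field) \<Rightarrow> nat \<Rightarrow> 'k mpoly3 set" where
  "J v n \<equiv> pt_ideal_pow (proj_pt v) n"

text \<open>A linear form that vanishes at \<open>v\<close> vanishes on its whole class, so one
  representative suffices and generators become lists of coefficient vectors.\<close>

lemma J_eq: "J v n = ideal_gen {prod_list (map Lin as) | as. length as = n \<and> (\<forall>a\<in>set as. dot a v = 0)}"
proof -
  have van: "(\<forall>w\<in>proj_pt v. eval3 (Lin a) w = 0) \<longleftrightarrow> dot a v = 0" for a
  proof -
    have "dot a (\<lambda>i. c * v i) = c * dot a v" for c
      by (simp add: dot_def sum_distrib_left ac_simps)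
    then show ?thesis
      by (auto simp: proj_pt_def eval3_Lin intro!: exI[of _ 1] dest: spec[of _ v])
  qed
  have "(\<exists>Ls. p = prod_list Ls \<and> length Ls = n \<and> (\<forall>L\<in>set Ls. homog L 1 \<and> (\<forall>w\<in>proj_pt v. eval3 L w = 0)))
    \<longleftrightarrow> (\<exists>as. p = prod_list (map Lin as) \<and> length as = n \<and> (\<forall>a\<in>set as. dot a v = 0))" (is "?l \<longleftrightarrow> ?r") for p
  proof
    assume ?l
    then obtain Ls where Ls: "p = prod_list Ls" "length Ls = n"
      "\<forall>L\<in>set Ls. homog L 1 \<and> (\<forall>w\<in>proj_pt v. eval3 L w = 0)" by blast
    then have "\<forall>L\<in>set Ls. \<exists>a. L = Lin a" using homog_1_imp_Lin by blast
    then have "\<exists>as. Ls = map Lin as" by (simp add: ex_map_conv)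
    then show ?r using Ls van by fastforce
  next
    assume ?r
    then obtain as where "p = prod_list (map Lin as)" "length as = n" "\<forall>a\<in>set as. dot a v = 0"
      by blast
    then show ?l by (intro exI[of _ "map Lin as"]) (auto simp: van homog_Lin[simplified])
  qed
  then show ?thesis unfolding pt_ideal_pow_def by auto
qed

lemma J_zero: "0 \<in> J v n"
  unfolding J_eq ideal_gen_def by (auto intro!: exI[of _ "{}"])

lemma J_gen: "length as = n \<Longrightarrow> \<forall>a\<in>set as. dot a v = 0 \<Longrightarrow> G * prod_list (map Lin as) \<in> J v n"
  unfolding J_eq ideal_gen_def
  by (auto intro!: exI[of _ "{prod_list (map Lin as)}"] exI[of _ "\<lambda>_. G"])

lemma J_add:
  assumes "F \<in> J v n" "G \<in> J v n" shows "F + G \<in> J v n"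
proof -
  obtain A f B g where A: "finite A" "A \<subseteq> {prod_list (map Lin as) | as. length as = n \<and> (\<forall>a\<in>set as. dot a v = 0)}"
    "F = (\<Sum>a\<in>A. f a * a)" and
    B: "finite B" "B \<subseteq> {prod_list (map Lin as) | as. length as = n \<and> (\<forall>a\<in>set as. dot a v = 0)}"
    "G = (\<Sum>a\<in>B. g a * a)"
    using assms unfolding J_eq ideal_gen_def by blast
  let ?f = "\<lambda>a. if a \<in> A then f a else 0" and ?g = "\<lambda>a. if a \<in> B then g a else 0"
  have "F = (\<Sum>a\<in>A \<union> B. ?f a * a)"
    unfolding A by (rule sum.mono_neutral_cong_left) (use A B in auto)
  moreover have "G = (\<Sum>a\<in>A \<union> B. ?g a * a)"
    unfolding B by (rule sum.mono_neutral_cong_left) (use A B in auto)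
  ultimately have "F + G = (\<Sum>a\<in>A \<union> B. (?f a + ?g a) * a)"
    by (simp add: sum.distrib distrib_right)
  then show ?thesis
    using A(1,2) B(1,2) unfolding J_eq ideal_gen_def
    by (intro CollectI exI[of _ "A \<union> B"] exI[of _ "\<lambda>a. ?f a + ?g a"]) blast
qed

lemma J_sum: "(\<And>x. x \<in> A \<Longrightarrow> f x \<in> J v n) \<Longrightarrow> sum f A \<in> J v n"
  by (induction A rule: infinite_finite_induct) (auto intro: J_zero J_add)

lemma J_induct [consumes 1, case_names zero add gen]:
  assumes "F \<in> J v n" "P 0" "\<And>F G. P F \<Longrightarrow> P G \<Longrightarrow> P (F + G)"
    "\<And>as G. length as = n \<Longrightarrow> \<forall>a\<in>set as. dot a v = 0 \<Longrightarrow> P (G * prod_list (map Lin as))"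
  shows "P F"
proof -
  obtain A f where A: "finite A" "A \<subseteq> {prod_list (map Lin as) | as. length as = n \<and> (\<forall>a\<in>set as. dot a v = 0)}"
    "F = (\<Sum>a\<in>A. f a * a)"
    using assms(1) unfolding J_eq ideal_gen_def by blast
  have "P (\<Sum>a\<in>A. f a * a)"
    using A(1,2) by (induction A rule: finite_induct) (use assms(2,3,4) in auto)
  then show ?thesis using A by simp
qed

lemma J_mult_left: "F \<in> J v n \<Longrightarrow> G * F \<in> J v n"
proof (induction rule: J_induct)
  case (gen as H)
  then show ?case using J_gen[of as n v "G * H"] by (simp add: mult.assoc)
qed (auto simp: distrib_left intro: J_zero J_add)

lemma J_mult: 
  assumes "F \<in> J v n" "G \<in> J v k" shows "F * G \<in> J v (n + k)"
  using assms(1)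
proof (induction rule: J_induct)
  case (gen as H)
  from assms(2) show ?case
  proof (induction rule: J_induct)
    case (gen bs K)
    then show ?case 
      using J_gen[of "as @ bs" "n + k" v "H * K"] \<open>length as = n\<close> \<open>\<forall>a\<in>set as. dot a v = 0\<close>
      by (simp add: ac_simps ball_Un)
  qed (auto simp: distrib_left intro: J_zero J_add)
qed (auto simp: distrib_right intro: J_zero J_add)

lemma J_0: "F \<in> J v 0"
  using J_gen[of "[]" 0 v F] by simp

lemma J_Lin: "dot a v = 0 \<Longrightarrow> Lin a \<in> J v 1"
  using J_gen[of "[a]" 1 v 1] by simp

lemma J_antimono:
  assumes "F \<in> J v n" "k \<le> n" shows "F \<in> J v k"
  using assms(1)
proof (induction rule: J_induct)
  case (gen as H)
  have "prod_list (map Lin as) = prod_list (map Lin (drop k as)) * prod_list (map Lin (take k as))"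
    by (metis append_take_drop_id map_append mult.commute prod_list.append)
  then show ?case
    using J_gen[of "take k as" k v "H * prod_list (map Lin (drop k as))"] gen assms(2)
    by (auto simp: mult.assoc dest: in_set_takeD)
qed (auto intro: J_zero J_add)

text \<open>Writing \<open>l\<close> for a linear form with \<open>l(v) = 1\<close>, each coordinate splits as \<open>l v\<^sub>i + (x\<^sub>i - l v\<^sub>i)\<close>
  with second part vanishing at \<open>v\<close>; scaling this part by an indeterminate turns membership
  in the \<open>n\<close>-th power of the ideal of \<open>v\<close> into divisibility by the \<open>n\<close>-th power of the indeterminate.\<close>

definition expand_at :: "(3 \<Rightarrow> 'k::field) \<Rightarrow> (3 \<Rightarrow> 'k) \<Rightarrow> 'k mpoly3 \<Rightarrow> 'k mpoly3 poly" where
  "expand_at l v F =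
     subst3 (\<lambda>c. [:C3 c:]) (\<lambda>i. [:Lin l * C3 (v i), X3 i - Lin l * C3 (v i):]) F"

lemma ring_hom_expand_at: "ring_hom (expand_at l v)"
  unfolding expand_at_def[abs_def] by (intro ring_hom_subst3 ring_hom_const_poly ring_hom_C3)

lemma expand_at_C3: "expand_at l v (C3 c) = [:C3 c:]"
  and expand_at_X3: "expand_at l v (X3 i) = [:Lin l * C3 (v i), X3 i - Lin l * C3 (v i):]"
  by (simp_all add: expand_at_def subst3_C3 subst3_X3 ring_hom_const_poly ring_hom_C3)

lemma C3_sum: "C3 (sum f A) = (\<Sum>x\<in>A. C3 (f x))"
  using ring_hom_sum[OF ring_hom_C3] .

lemma C3_mult: "C3 (a * b) = C3 a * C3 b"
  by (simp add: mult_single)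

lemma expand_at_Lin:
  "expand_at l v (Lin a) = [:C3 (dot a v) * Lin l, Lin a - C3 (dot a v) * Lin l:]"
  unfolding dot_def Lin_def[of a] sum_3
  by (simp add: ring_hom_simps[OF ring_hom_expand_at] expand_at_C3 expand_at_X3
      single_add C3_mult algebra_simps)

lemma poly_expand_at: "poly (expand_at l v F) 1 = F"
  unfolding expand_at_def
  by (simp add: subst3_hom[OF ring_hom_const_poly[OF ring_hom_C3] ring_hom_poly] subst3_ident)

text \<open>The indeterminate counts factors vanishing at \<open>v\<close>. Multiplicativity reduces
  the claim to the variables, where \<open>dot l v = 1\<close> makes the linear coefficient x_i -
  v_i l vanish at \<open>v\<close>.\<close>

lemma coeff_expand_at_in_J:
  assumes "dot l v = 1"
  shows "coeff (expand_at l v F) k \<in> J v k"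
proof (induction F arbitrary: k rule: mpoly3_induct)
  case (C3 c)
  then show ?case by (cases k) (auto simp: expand_at_C3 J_0 J_zero)
next
  case (X3 i)
  have "X3 i - Lin l * C3 (v i) = Lin (\<lambda>j. (if j = i then 1 else 0) - v i * l j)"
    using cases_3[of i]
    by (auto simp: Lin_def sum_3 single_diff C3_mult algebra_simps)
  moreover have "dot (\<lambda>j. (if j = i then 1 else 0) - v i * l j) v = 0"
  proof -
    have "dot (\<lambda>j. (if j = i then 1 else 0) - v i * l j) v = v i - v i * dot l v"
      using cases_3[of i] by (auto simp: dot_def sum_3 algebra_simps)
    then show ?thesis using assms by simp
  qed
  ultimately show ?case
    using J_Lin[of _ v] by (auto simp: expand_at_X3 coeff_pCons J_0 J_zero split: nat.split)
next
  case (add F G)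
  then show ?case by (simp add: ring_hom_simps[OF ring_hom_expand_at] J_add)
next
  case (mult F G)
  have "coeff (expand_at l v F) i * coeff (expand_at l v G) (k - i) \<in> J v k" if "i \<le> k" for i
    using J_mult[OF mult.IH(1)[of i] mult.IH(2)[of "k - i"]] that by simp
  then show ?case by (auto simp: ring_hom_simps[OF ring_hom_expand_at] coeff_mult intro!: J_sum)
qed

text \<open>Each generator of the power carries \<open>n\<close> factors without constant term.
  Conversely, setting the indeterminate to 1 recovers \<open>F\<close> as the sum of its
  coefficients, all of which lie in \<open>J v n\<close>.\<close>

lemma J_iff_expand_at:
  assumes "dot l v = 1"
  shows "F \<in> J v n \<longleftrightarrow> (\<forall>k<n. coeff (expand_at l v F) k = 0)"
proof
  assume "F \<in> J v n"
  then have "monom 1 n dvd expand_at l v F"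
  proof (induction rule: J_induct)
    case (gen as G)
    have "monom 1 (length as) dvd expand_at l v (prod_list (map Lin as))"
      using gen(2)
    proof (induction as)
      case Nil
      then show ?case by (simp add: monom_1_dvd_iff')
    next
      case (Cons a as)
      have "monom 1 1 dvd expand_at l v (Lin a)"
        using Cons by (simp add: monom_1_dvd_iff' expand_at_Lin)
      then have "monom 1 1 * monom 1 (length as) dvd expand_at l v (Lin a) * expand_at l v (prod_list (map Lin as))"
        using Cons by (intro mult_dvd_mono) auto
      then show ?case by (simp add: mult_monom ring_hom_simps[OF ring_hom_expand_at])
    qed
    then show ?case using gen(1) by (simp add: ring_hom_simps[OF ring_hom_expand_at])
  qed (auto simp: ring_hom_simps[OF ring_hom_expand_at])
  then show "\<forall>k<n. coeff (expand_at l v F) k = 0" by (simp add: monom_1_dvd_iff')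
next
  assume *: "\<forall>k<n. coeff (expand_at l v F) k = 0"
  have "F = (\<Sum>k\<le>degree (expand_at l v F). coeff (expand_at l v F) k)"
    using poly_expand_at[of l v F] by (simp add: poly_altdef)
  moreover have "coeff (expand_at l v F) k \<in> J v n" for k
    using * J_antimono[OF coeff_expand_at_in_J[OF assms]] J_zero by (cases "k < n") (auto simp: not_less)
  ultimately show "F \<in> J v n" by (metis J_sum)
qed

lemma exists_dot_1:
  fixes v :: "3 \<Rightarrow> 'k::field"
  assumes "v \<noteq> (\<lambda>_. 0)" shows "\<exists>l. dot l v = 1"
proof -
  obtain i where i: "v i \<noteq> 0" using assms by auto
  have "dot (\<lambda>j. if j = i then 1 / v i else 0) v = 1"
    using i cases_3[of i] by (auto simp: dot_def sum_3)
  then show ?thesis by blast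
qed

text \<open>With \<open>dot a v = 0\<close> the expansion of \<open>Lin a\<close> is
  \<open>Lin a\<close> times the indeterminate, so multiplying by it shifts the expansion of
  \<open>G\<close> by exactly one step.\<close>

lemma J_Lin_mult_imp:
  assumes "v \<noteq> (\<lambda>_. 0)" "a \<noteq> (\<lambda>_. 0)" "dot a v = 0" "Lin a * G \<in> J v (Suc n)"
  shows "G \<in> J v n"
proof -
  obtain l where l: "dot l v = 1" using exists_dot_1 assms by blast
  have "coeff (expand_at l v G) k = 0" if "k < n" for k
  proof -
    have "coeff (expand_at l v (Lin a * G)) (Suc k) = 0"
      using assms(4) that unfolding J_iff_expand_at[OF l] by simp
    then show ?thesis
      using assms(2,3) by (simp add: ring_hom_simps[OF ring_hom_expand_at] expand_at_Lin Lin_eq_0_iff)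
  qed
  then show ?thesis unfolding J_iff_expand_at[OF l] by blast
qed

text \<open>The constant term of the expansion of \<open>Lin a\<close> is now nonzero, so the low
  coefficients of \<open>G\<close> vanish one after the other.\<close>

lemma J_Lin_mult_imp_nonvanishing:
  assumes "v \<noteq> (\<lambda>_. 0)" "dot a v \<noteq> 0" "Lin a * G \<in> J v n"
  shows "G \<in> J v n"
proof -
  obtain l where l: "dot l v = 1" using exists_dot_1 assms by blast
  then have l0: "l \<noteq> (\<lambda>_. 0)" by (auto simp: dot_def)
  have "C3 (dot a v) * Lin l \<noteq> 0"
    using assms(2) l0 by (auto simp: Lin_eq_0_iff dest: arg_cong[where f = "\<lambda>p. Poly_Mapping.lookup p 0"])
  have "coeff (expand_at l v G) k = 0" if "k < n" for k
    using that
  proof (induction k)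
    case 0
    then have "coeff (expand_at l v (Lin a * G)) 0 = 0"
      using assms(3) unfolding J_iff_expand_at[OF l] by simp
    then show ?case using \<open>C3 (dot a v) * Lin l \<noteq> 0\<close>
      by (simp add: ring_hom_simps[OF ring_hom_expand_at] expand_at_Lin coeff_mult)
  next
    case (Suc k)
    then have "coeff (expand_at l v (Lin a * G)) (Suc k) = 0"
      using assms(3) unfolding J_iff_expand_at[OF l] by simp
    then show ?case using Suc \<open>C3 (dot a v) * Lin l \<noteq> 0\<close>
      by (simp add: ring_hom_simps[OF ring_hom_expand_at] expand_at_Lin)
  qed
  then show ?thesis unfolding J_iff_expand_at[OF l] by blast
qed

subsection \<open>Points and lines in coordinates\<close>

lemma cross_simps:
  "cross a b 0 = a 1 * b 2 - a 2 * b 1"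
  "cross a b 1 = a 2 * b 0 - a 0 * b 2"
  "cross a b 2 = a 0 * b 1 - a 1 * b 0"
  by (simp_all add: cross_def)

lemma fun_eq_3: "f = g \<longleftrightarrow> f 0 = g 0 \<and> f 1 = g 1 \<and> f (2::3) = g 2"
  by (simp add: fun_eq_iff all_3)

lemma dot_commute: "dot a b = dot b a"
  by (simp add: dot_def mult.commute)

lemma dot_cross_self [simp]: "dot a (cross a b) = 0" "dot b (cross a b) = 0"
  "dot (cross a b) a = 0" "dot (cross a b) b = 0"
  by (simp_all add: dot_def sum_3 cross_simps algebra_simps)

lemma cross_antisym: "cross a b = (\<lambda>i. - cross b a i)"
  by (simp add: fun_eq_3 cross_simps)

lemma cross_eq_0_commute: "cross a b = (\<lambda>_. 0) \<longleftrightarrow> cross b a = (\<lambda>_. 0)"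
  by (subst cross_antisym) (auto simp: fun_eq_iff)

text \<open>Cramer's rule for the basis dual to \<open>k\<close>, \<open>a\<close>,
  \<open>l\<close>, up to the determinant. It holds over any commutative ring and is also applied to
  the vector of variables.\<close>

lemma dual_basis_expansion:
  "dot k (cross a l) * x i = dot k x * cross a l i + dot a x * cross l k i + dot l x * cross k a i"
  using cases_3[of i] by (elim disjE) (simp_all add: dot_def sum_3 cross_simps algebra_simps)

lemma cross_nonzero:
  fixes a b q :: "3 \<Rightarrow> 'k::field"
  assumes "a \<noteq> (\<lambda>_. 0)" "dot a q = 0" "dot b q \<noteq> 0"
  shows "cross a b \<noteq> (\<lambda>_. 0)" "cross b a \<noteq> (\<lambda>_. 0)"
proof -
  show "cross a b \<noteq> (\<lambda>_. 0)"
  proof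
    assume "cross a b = (\<lambda>_. 0)"
    then have eqs: "a 1 * b 2 = a 2 * b 1" "a 2 * b 0 = a 0 * b 2" "a 0 * b 1 = a 1 * b 0"
      by (auto simp: fun_eq_3 cross_simps)
    have "a i * dot b q = b i * dot a q" for i
      using cases_3[of i]
    proof (elim disjE)
      assume "i = 0"
      then show ?thesis unfolding dot_def sum_3 distrib_left mult.assoc[symmetric]
        using eqs by (metis mult.commute)
    next
      assume "i = 1"
      then show ?thesis unfolding dot_def sum_3 distrib_left mult.assoc[symmetric]
        using eqs by (metis mult.commute)
    next
      assume "i = 2"
      then show ?thesis unfolding dot_def sum_3 distrib_left mult.assoc[symmetric]
        using eqs by (metis mult.commute)
    qed
    then have "a i = 0" for i using assms(2,3) by simp
    then show False using assms(1) by auto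
  qed
  then show "cross b a \<noteq> (\<lambda>_. 0)" by (simp add: cross_eq_0_commute)
qed

lemma orthogonal_imp_multiple_cross:
  fixes a b v :: "3 \<Rightarrow> 'k::field"
  assumes "cross a b \<noteq> (\<lambda>_. 0)" "dot a v = 0" "dot b v = 0"
  shows "\<exists>c. v = (\<lambda>i. c * cross a b i)"
proof -
  obtain k where "dot k (cross a b) = 1" using exists_dot_1 assms(1) by blast
  then show ?thesis
    using dual_basis_expansion[of k a b v] assms(2,3) by (intro exI[of _ "dot k v"]) (auto simp: fun_eq_iff)
qed

lemma dot_scale: "dot a (\<lambda>i. c * b i) = c * dot a b" "dot (\<lambda>i. c * a i) b = c * dot a b"
  by (simp_all add: dot_def sum_distrib_left ac_simps)

lemma two_common_points_imp_same_line:
  fixes a b v w :: "3 \<Rightarrow> 'k::field"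
  assumes "cross v w \<noteq> (\<lambda>_. 0)" "dot a v = 0" "dot a w = 0" "dot b v = 0" "dot b w = 0"
  shows "cross a b = (\<lambda>_. 0)"
proof -
  obtain c where "a = (\<lambda>i. c * cross v w i)"
    using orthogonal_imp_multiple_cross[OF assms(1), of a] assms by (auto simp: dot_commute)
  moreover obtain d where "b = (\<lambda>i. d * cross v w i)"
    using orthogonal_imp_multiple_cross[OF assms(1), of b] assms by (auto simp: dot_commute)
  ultimately show ?thesis by (simp add: fun_eq_3 cross_def)
qed

text \<open>\<open>cross a l\<close> is where \<open>a\<close> meets \<open>l\<close>, while the
  only common point of \<open>a\<close> and \<open>b\<close> is \<open>q\<close>, which is off
  \<open>l\<close>.\<close>

lemma dot_cross_nonzero:
  fixes a b l q :: "3 \<Rightarrow> 'k::field"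
  assumes "cross a b \<noteq> (\<lambda>_. 0)" "dot a q = 0" "dot b q = 0" "dot l q \<noteq> 0"
  shows "dot b (cross a l) \<noteq> 0"
proof -
  obtain c where c: "q = (\<lambda>i. c * cross a b i)"
    using orthogonal_imp_multiple_cross assms by blast
  then have "dot l (cross a b) \<noteq> 0" using assms(4) by (auto simp: dot_scale)
  moreover have "dot b (cross a l) = - dot l (cross a b)"
    by (simp add: dot_def sum_3 cross_simps algebra_simps)
  ultimately show ?thesis by simp
qed

lemma exists_line_through_avoiding:
  fixes p q :: "3 \<Rightarrow> 'k::field"
  assumes "cross q p \<noteq> (\<lambda>_. 0)"
  shows "\<exists>b. dot b q = 0 \<and> dot b p \<noteq> 0"
proof -
  \<comment> \<open>By the triple product, the line \<open>cross q w\<close> takes at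
    \<open>p\<close> the value of \<open>w\<close> at \<open>cross p q\<close>.\<close>
  obtain w where "dot w (cross p q) = 1" using exists_dot_1 assms cross_eq_0_commute by blast
  moreover have "dot (cross q w) p = dot w (cross p q)"
    by (simp add: dot_def sum_3 cross_simps algebra_simps)
  ultimately show ?thesis by (intro exI[of _ "cross q w"]) simp
qed

lemma exists_line_through:
  fixes q :: "3 \<Rightarrow> 'k::field"
  shows "\<exists>a. a \<noteq> (\<lambda>_. 0) \<and> dot a q = 0"
proof (cases "q 0 = 0 \<and> q 1 = 0")
  case True
  then show ?thesis
    by (intro exI[of _ "\<lambda>i. if i = 0 then 1 else 0"]) (auto simp: dot_def sum_3 fun_eq_3)
next
  case False
  then show ?thesis
    by (intro exI[of _ "\<lambda>i. if i = 0 then q 1 else if i = 1 then - q 0 else 0"])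
      (auto simp: dot_def sum_3 fun_eq_3)
qed

subsection \<open>Ideals of lines\<close>

text \<open>Congruent values of the variables modulo an ideal give congruent values of a polynomial;
  \<open>I\<close> is any set with the closure properties of an ideal.\<close>

lemma subst3_diff_in_ideal:
  assumes "\<And>i. X3 i - y i \<in> I" "0 \<in> I"
    "\<And>F G. F \<in> I \<Longrightarrow> G \<in> I \<Longrightarrow> F + G \<in> I" "\<And>F G. F \<in> I \<Longrightarrow> G * F \<in> I"
  shows "F - subst3 C3 y F \<in> I"
proof (induction F rule: mpoly3_induct)
  case (C3 c)
  then show ?case using assms(2) by (simp add: subst3_C3 ring_hom_C3)
next
  case (X3 i)
  then show ?case using assms(1) by (simp add: subst3_X3 ring_hom_C3)
next
  case (add F G)
  then have "(F - subst3 C3 y F) + (G - subst3 C3 y G) \<in> I" using assms by blast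
  then show ?case by (simp add: subst3_add ring_hom_C3 algebra_simps)
next
  case (mult F G)
  then have "G * (F - subst3 C3 y F) + subst3 C3 y F * (G - subst3 C3 y G) \<in> I" using assms by blast
  then show ?case by (simp add: subst3_mult ring_hom_C3 algebra_simps)
qed

lemma X3_expansion:
  assumes "dot k (cross a l) = 1"
  shows "X3 i = Lin k * C3 (cross a l i) + Lin a * C3 (cross l k i) + Lin l * C3 (cross k a i)"
proof -
  let ?e = "\<lambda>a i. C3 (a i)"
  have cr: "cross (?e a) (?e b) = ?e (cross a b)" for a b
    by (simp add: fun_eq_3 cross_simps single_diff C3_mult)
  have dt: "dot (?e a) (?e b) = C3 (dot a b)" for a b
    unfolding dot_def C3_sum C3_mult ..
  have lin: "dot (?e b) X3 = Lin b" for b by (simp add: dot_def Lin_def)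
  show ?thesis
    using dual_basis_expansion[of "?e k" "?e a" "?e l" X3 i] by (simp add: cr dt lin assms)
qed

text \<open>Modulo both lines each variable is \<open>Lin k\<close> times a coordinate of their
  common point, so \<open>F\<close> is congruent to its value there times a power of
  \<open>Lin k\<close>. Homogeneity is recorded for the cofactor of \<open>a\<close>, with which the
  peeling continues; multiples of \<open>l\<close> are discarded.\<close>

lemma vanish_imp_in_two_lines:
  assumes "dot k (cross a l) = 1" "homog F (Suc e)" "eval3 F (cross a l) = 0"
  shows "\<exists>A B. homog A e \<and> F = Lin a * A + Lin l * B"
proof -
  let ?I = "{Lin a * A + Lin l * B | A B. True}"
  let ?y = "\<lambda>i. Lin k * C3 (cross a l i)"
  have I_add: "F + G \<in> ?I" if FG: "F \<in> ?I" "G \<in> ?I" for F G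
  proof -
    obtain A B A' B' where "F = Lin a * A + Lin l * B" "G = Lin a * A' + Lin l * B'"
      using FG by blast
    then have "F + G = Lin a * (A + A') + Lin l * (B + B')" by (simp add: algebra_simps)
    then show ?thesis by blast
  qed
  have I_mult: "G * F \<in> ?I" if F: "F \<in> ?I" for F G
  proof -
    obtain A B where "F = Lin a * A + Lin l * B" using F by blast
    then have "G * F = Lin a * (G * A) + Lin l * (G * B)" by (simp add: algebra_simps)
    then show ?thesis by blast
  qed
  have "X3 i - ?y i = Lin a * C3 (cross l k i) + Lin l * C3 (cross k a i)" for i
    using X3_expansion[OF assms(1), of i] by (simp add: algebra_simps)
  then have "X3 i - ?y i \<in> ?I" for i by blast
  moreover have "0 \<in> ?I" by (auto intro!: exI[of _ 0])
  ultimately have "F - subst3 C3 ?y F \<in> ?I"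
    using I_add I_mult by (intro subst3_diff_in_ideal)
  moreover have "subst3 C3 ?y F = 0"
    using subst3_hom[OF ring_hom_id ring_hom_C3, of "cross a l" F] assms(3)
    by (simp add: subst3_homog_scale[OF assms(2)] eval3_eq_subst3)
  ultimately obtain A B where AB: "F = Lin a * A + Lin l * B" by auto
  \<comment> \<open>Taking the component of degree \<open>Suc e\<close> on both sides makes the
    cofactors homogeneous.\<close>
  have "coeff (grade F) (Suc e) = F" using assms(2) by (simp add: homog_iff_grade)
  then have "F = Lin a * coeff (grade A) e + Lin l * coeff (grade B) e"
    by (metis AB coeff_add coeff_grade_Lin_mult grade_add)
  then show ?thesis using homog_coeff_grade by blast
qed

lemma eval3_prod_Lin: "eval3 (prod_list (map Lin bs)) p = prod_list (map (\<lambda>b. dot b p) bs)"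
proof (induction bs)
  case Nil
  then show ?case by (simp add: eval3_eq_subst3 ring_hom_simps[OF ring_hom_subst3[OF ring_hom_id]])
next
  case (Cons b bs)
  then show ?case
    by (simp add: eval3_Lin[symmetric] eval3_eq_subst3 subst3_mult ring_hom_id)
qed

lemma prod_Lin_in_J: "prod_list (map Lin bs) \<in> J v (length (filter (\<lambda>b. dot b v = 0) bs))"
proof (induction bs)
  case Nil
  then show ?case by (simp add: J_0)
next
  case (Cons b bs)
  then show ?case
    using J_mult[OF J_Lin, of b v] by (auto intro: J_mult_left)
qed

text \<open>The substitution solves the equation of the line for the variable \<open>i\<close>, and
  its kernel is the ideal of \<open>Lin a\<close>. Since its target is a domain,
  \<open>Lin a\<close> is prime.\<close>

lemma Lin_dvd_iff:
  assumes "a i \<noteq> 0"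
  shows "Lin a dvd F \<longleftrightarrow> subst3 C3 (\<lambda>j. X3 j - Lin a * C3 (if j = i then 1 / a i else 0)) F = 0"
proof -
  let ?y = "\<lambda>j. X3 j - Lin a * C3 (if j = i then 1 / a i else 0)"
  have "X3 j - ?y j \<in> {F. Lin a dvd F}" for j by simp
  then have *: "F - subst3 C3 ?y F \<in> {F. Lin a dvd F}"
    by (rule subst3_diff_in_ideal) auto
  have "subst3 C3 ?y (Lin a) = Lin a - Lin a * C3 (dot a (\<lambda>j. if j = i then 1 / a i else 0))"
  proof -
    have "(\<Sum>j\<in>UNIV. C3 (a j) * (X3 j - L * C3 (d j))) = Lin a - L * C3 (dot a d)" for L d
      by (simp add: Lin_def dot_def sum_3 single_add C3_mult algebra_simps)
    then show ?thesis unfolding subst3_Lin[OF ring_hom_C3] .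
  qed
  also have "dot a (\<lambda>j. if j = i then 1 / a i else 0) = 1"
    using assms by (simp add: dot_def if_distrib cong: if_cong)
  finally have "subst3 C3 ?y (Lin a) = 0" by simp
  then show ?thesis
    using * by (auto simp: subst3_mult ring_hom_C3 elim!: dvdE)
qed

lemma Lin_dvd_mult_iff:
  assumes "a \<noteq> (\<lambda>_. 0)" shows "Lin a dvd F * G \<longleftrightarrow> Lin a dvd F \<or> Lin a dvd G"
proof -
  obtain i where "a i \<noteq> 0" using assms by auto
  then show ?thesis by (simp add: Lin_dvd_iff[of a i] subst3_mult ring_hom_C3)
qed

lemma Lin_not_dvd_1:
  assumes "a \<noteq> (\<lambda>_. 0)" shows "\<not> Lin a dvd 1"
proof -
  obtain i where "a i \<noteq> 0" using assms by auto
  then show ?thesis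
    by (simp add: Lin_dvd_iff[of a i] ring_hom_simps[OF ring_hom_subst3[OF ring_hom_C3]])
qed

lemma Lin_dvd_prod_imp:
  assumes "a \<noteq> (\<lambda>_. 0)" "Lin a dvd (\<Prod>b\<in>\<Lambda>. f b)"
  shows "\<exists>b\<in>\<Lambda>. Lin a dvd f b"
  using assms(2)
  by (induction \<Lambda> rule: infinite_finite_induct)
    (auto simp: Lin_dvd_mult_iff[OF assms(1)] Lin_not_dvd_1[OF assms(1)])

text \<open>If the lines were different, a point on \<open>a\<close> and off \<open>b\<close> would
  refute divisibility.\<close>

lemma Lin_dvd_Lin_imp:
  assumes "Lin a dvd Lin b" shows "cross a b = (\<lambda>_. 0)"
proof (rule ccontr)
  assume "cross a b \<noteq> (\<lambda>_. 0)"
  then obtain v where "dot v a = 0" "dot v b \<noteq> 0"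
    using exists_line_through_avoiding by blast
  moreover obtain G where "Lin b = Lin a * G" using assms by (auto elim: dvdE)
  then have "eval3 (Lin b) v = eval3 (Lin a) v * eval3 G v"
    by (simp add: eval3_eq_subst3 subst3_mult ring_hom_id)
  ultimately show False by (simp add: eval3_Lin dot_commute)
qed

lemma prod_Lin_dvd:
  assumes "finite \<Lambda>" "\<And>a. a \<in> \<Lambda> \<Longrightarrow> a \<noteq> (\<lambda>_. 0)" "\<And>a. a \<in> \<Lambda> \<Longrightarrow> Lin a dvd F"
    "\<And>a b. a \<in> \<Lambda> \<Longrightarrow> b \<in> \<Lambda> \<Longrightarrow> a \<noteq> b \<Longrightarrow> cross a b \<noteq> (\<lambda>_. 0)"
  shows "(\<Prod>a\<in>\<Lambda>. Lin a) dvd F"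
  using assms
proof (induction \<Lambda> rule: finite_induct)
  case (insert a \<Lambda>)
  then have "(\<Prod>a\<in>\<Lambda>. Lin a) dvd F" by blast
  then obtain G where G: "F = (\<Prod>a\<in>\<Lambda>. Lin a) * G" by (auto elim: dvdE)
  have a: "a \<noteq> (\<lambda>_. 0)" using insert.prems by auto
  have "Lin a dvd (\<Prod>a\<in>\<Lambda>. Lin a) * G" using insert.prems(2)[of a] G by simp
  moreover have "\<not> Lin a dvd (\<Prod>a\<in>\<Lambda>. Lin a)"
    using Lin_dvd_prod_imp[OF a, of Lin] insert.prems(3)[of a] insert.hyps
    by (metis Lin_dvd_Lin_imp insert_iff)
  ultimately have "Lin a dvd G" by (simp add: Lin_dvd_mult_iff[OF a])
  then show ?case using insert.hyps G by (auto simp: mult.commute intro!: mult_dvd_mono)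
qed simp

lemma prod_Lin_set_in_J:
  assumes "finite \<Lambda>" shows "(\<Prod>a\<in>\<Lambda>. Lin a) \<in> J v (card {a \<in> \<Lambda>. dot a v = 0})"
  using assms
proof (induction \<Lambda> rule: finite_induct)
  case empty
  then show ?case by (simp add: J_0)
next
  case (insert a \<Lambda>)
  have "{b \<in> insert a \<Lambda>. dot b v = 0} = (if dot a v = 0 then insert a {b \<in> \<Lambda>. dot b v = 0} else {b \<in> \<Lambda>. dot b v = 0})"
    by auto
  then show ?case
    using insert J_mult[OF J_Lin, of a v] by (auto intro: J_mult_left)
qed

text \<open>Every line through \<open>v\<close> lowers the multiplicity by exactly one and the
  others leave it alone; truncated subtraction covers the case that the lines alone already give
  multiplicity \<open>n\<close>.\<close>

lemma prod_Lin_mult_in_J_iff: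
  assumes "finite \<Lambda>" "\<And>a. a \<in> \<Lambda> \<Longrightarrow> a \<noteq> (\<lambda>_. 0)" "v \<noteq> (\<lambda>_. 0)"
  shows "(\<Prod>a\<in>\<Lambda>. Lin a) * G \<in> J v n \<longleftrightarrow> G \<in> J v (n - card {a \<in> \<Lambda>. dot a v = 0})"
proof
  show "(\<Prod>a\<in>\<Lambda>. Lin a) * G \<in> J v n \<Longrightarrow> G \<in> J v (n - card {a \<in> \<Lambda>. dot a v = 0})"
    using assms(1,2)
  proof (induction \<Lambda> arbitrary: n rule: finite_induct)
    case (insert a \<Lambda>)
    let ?P = "\<Prod>a\<in>\<Lambda>. Lin a"
    have in_J: "Lin a * (?P * G) \<in> J v n" using insert by (simp add: mult.assoc)
    show ?case
    proof (cases "dot a v = 0")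
      case True
      have "?P * G \<in> J v (n - 1)"
      proof (cases n)
        case (Suc k)
        then show ?thesis using J_Lin_mult_imp[OF assms(3) _ True, of "?P * G" k] in_J insert by simp
      qed (simp add: J_0)
      then have "G \<in> J v (n - 1 - card {a \<in> \<Lambda>. dot a v = 0})" using insert.IH insert.prems by blast
      moreover have "{b \<in> insert a \<Lambda>. dot b v = 0} = insert a {b \<in> \<Lambda>. dot b v = 0}"
        using True by auto
      ultimately show ?thesis using insert.hyps by simp
    next
      case False
      then have "{b \<in> insert a \<Lambda>. dot b v = 0} = {b \<in> \<Lambda>. dot b v = 0}" by auto
      moreover have "?P * G \<in> J v n"
        using J_Lin_mult_imp_nonvanishing[OF assms(3) False in_J] .
      ultimately show ?thesis using insert by simp
    qed
  qed simp
next
  assume "G \<in> J v (n - card {a \<in> \<Lambda>. dot a v = 0})"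
  from J_mult[OF prod_Lin_set_in_J[OF assms(1), of v] this]
  show "(\<Prod>a\<in>\<Lambda>. Lin a) * G \<in> J v n" by (rule J_antimono) simp
qed

section \<open>Divisibility by a line that contains many fat points\<close>

text \<open>Stated over an integral domain because it is applied to one-variable polynomials whose
  coefficients lie in the ring of three variables.\<close>

lemma card_mult_roots_le_degree:
  fixes p :: "'a::idom poly"
  assumes "finite A" "p \<noteq> 0" "\<And>a. a \<in> A \<Longrightarrow> [:-a, 1:] ^ m dvd p"
  shows "m * card A \<le> degree p"
  using assms
proof (induction A arbitrary: p rule: finite_induct)
  case (insert a A)
  then obtain q where q: "p = [:-a, 1:] ^ m * q" by (meson dvdE insertI1)
  have "q \<noteq> 0" using insert.prems q by auto
  have "[:-b, 1:] ^ m dvd q" if b: "b \<in> A" for b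
  proof -
    have "order b ([:-a, 1:] ^ m) = 0"
      by (rule order_0I) (use b insert.hyps in auto)
    moreover have "m \<le> order b p"
      using insert.prems(2)[of b] insert.prems(1) b by (simp add: order_divides)
    ultimately show ?thesis
      using insert.prems(1) unfolding q by (simp add: order_mult order_divides)
  qed
  then have "m * card A \<le> degree q" by (intro insert.IH \<open>q \<noteq> 0\<close>)
  moreover have "degree p = m + degree q"
    unfolding q using \<open>q \<noteq> 0\<close> by (simp add: degree_mult_eq degree_linear_power)
  ultimately show ?case using insert.hyps by simp
qed simp

text \<open>On the line \<open>a\<close>, parametrised by \<open>T p + l u\<close>, every point of
  \<open>W\<close> becomes a root of multiplicity \<open>m\<close>, which is too many for the degree
  of \<open>F\<close>. Keeping \<open>Lin l\<close> as the second parameter lets the value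
  \<open>Lin k\<close> for \<open>T\<close> turn the vanishing restriction back into a congruence
  modulo \<open>Lin a\<close>.\<close>

lemma Lin_dvd_of_many_points:
  fixes a l :: "3 \<Rightarrow> 'k::field"
  assumes a: "cross a l \<noteq> (\<lambda>_. 0)" and F: "homog F t" and W: "finite W"
    and on: "\<And>w. w \<in> W \<Longrightarrow> dot a w = 0" and off: "\<And>w. w \<in> W \<Longrightarrow> dot l w \<noteq> 0"
    and distinct: "\<And>v w. v \<in> W \<Longrightarrow> w \<in> W \<Longrightarrow> v \<noteq> w \<Longrightarrow> cross v w \<noteq> (\<lambda>_. 0)"
    and mult: "\<And>w. w \<in> W \<Longrightarrow> F \<in> J w m" and less: "t < m * card W"
  shows "Lin a dvd F"
proof -
  obtain k where k: "dot k (cross a l) = 1" using exists_dot_1 a by blast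
  define p where "p = cross a l"
  \<comment> \<open>A second point on \<open>a\<close>: there \<open>l\<close> takes the value 1 and
    \<open>k\<close> the value 0, the opposite of \<open>p\<close>.\<close>
  define u where "u = cross k a"
  define h where "h = subst3 (\<lambda>c. [:C3 c:]) (\<lambda>i. [:Lin l * C3 (u i), C3 (p i):])"
  have hom: "ring_hom h" unfolding h_def by (intro ring_hom_subst3 ring_hom_const_poly ring_hom_C3)
  \<comment> \<open>The root belonging to \<open>w\<close>, whose coordinates with respect to
    \<open>p\<close> and \<open>u\<close> are \<open>dot k w\<close> and
    \<open>dot l w\<close>.\<close>
  define z where "z w = Lin l * C3 (dot k w / dot l w)" for w
  have h_Lin: "h (Lin b) = [:Lin l * C3 (dot b u), C3 (dot b p):]" for b
    unfolding h_def subst3_Lin[OF ring_hom_const_poly[OF ring_hom_C3]] dot_def C3_sum C3_mult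
    by (simp add: sum_3 algebra_simps)
  have w_eq: "w i = dot k w * p i + dot l w * u i" if "w \<in> W" for w i
    using dual_basis_expansion[of k a l w i] k on[OF that] by (simp add: p_def u_def)
  have w_dot: "dot b w = dot k w * dot b p + dot l w * dot b u" if "w \<in> W" for w b
  proof -
    have "dot b w = (\<Sum>i\<in>UNIV. b i * (dot k w * p i + dot l w * u i))"
      unfolding dot_def[of b] using w_eq[OF that] by simp
    also have "\<dots> = dot k w * dot b p + dot l w * dot b u"
      by (simp add: dot_def[of b] sum_3 algebra_simps)
    finally show ?thesis .
  qed
  have dvd: "[:- z w, 1:] ^ m dvd h F" if w: "w \<in> W" for w
    using mult[OF w]
  proof (induction rule: J_induct)
    case (gen as G)
    have "[:- z w, 1:] ^ length as dvd h (prod_list (map Lin as))"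
      using gen(2)
    proof (induction as)
      case (Cons b as)
      have "dot b u = - (dot k w / dot l w * dot b p)"
        using w_dot[OF w, of b] off[OF w] Cons by (simp add: field_simps eq_neg_iff_add_eq_0)
      then have "h (Lin b) = [:C3 (dot b p):] * [:- z w, 1:]"
        unfolding h_Lin z_def by (simp add: mult_single single_uminus ac_simps)
      moreover have "[:- z w, 1:] ^ length as dvd h (prod_list (map Lin as))" using Cons by simp
      ultimately have "[:- z w, 1:] * [:- z w, 1:] ^ length as dvd h (Lin b) * h (prod_list (map Lin as))"
        by (metis dvd_triv_right mult_dvd_mono)
      then show ?case by (simp only: list.map prod_list.Cons ring_hom_simps[OF hom] list.size power_Suc add_Suc_right add_0_right)
    qed (simp add: ring_hom_simps[OF hom])
    then show ?case using gen(1) by (simp add: ring_hom_simps[OF hom])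
  qed (auto simp: ring_hom_simps[OF hom])
  have l0: "Lin l \<noteq> 0" using a by (auto simp: Lin_eq_0_iff fun_eq_3 cross_simps)
  have inj: "inj_on z W"
  proof (rule inj_onI, rule ccontr)
    fix v w assume vw: "v \<in> W" "w \<in> W" "z v = z w" "v \<noteq> w"
    then have "C3 (dot k v / dot l v) = C3 (dot k w / dot l w)" using l0 by (simp add: z_def)
    then have "dot k v / dot l v = dot k w / dot l w" by (metis lookup_single_eq)
    then have *: "dot k v * dot l w = dot k w * dot l v" using off vw by (simp add: field_simps)
    have "dot l w * v i = dot l v * w i" for i
      using arg_cong[OF *, of "\<lambda>x. x * p i"] unfolding w_eq[OF vw(1), of i] w_eq[OF vw(2), of i]
      by (simp add: algebra_simps)
    then have "(\<lambda>i. dot l w * v i) = (\<lambda>i. dot l v * w i)" by auto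
    then have "cross (\<lambda>i. dot l w * v i) v = cross (\<lambda>i. dot l v * w i) v" by simp
    then have "\<forall>i. dot l v * cross w v i = 0"
      by (auto simp: all_3 cross_simps fun_eq_3 algebra_simps)
    then have "cross w v = (\<lambda>_. 0)" using off[OF vw(1)] by auto
    then show False using distinct[OF vw(2,1)] vw(4) by auto
  qed
  have "h F = 0"
  proof (rule ccontr)
    assume nz: "h F \<noteq> 0"
    have "m * card W = m * card (z ` W)" by (simp add: card_image[OF inj])
    also have "\<dots> \<le> degree (h F)"
      by (rule card_mult_roots_le_degree[OF _ nz]) (use W dvd in auto)
    also have "\<dots> \<le> t" unfolding h_def by (intro degree_subst3_le[OF F]) simp
    finally show False using less by simp
  qed
  then have "poly (h F) (Lin k) = 0" by simp
  then have "subst3 C3 (\<lambda>i. Lin k * C3 (p i) + Lin l * C3 (u i)) F = 0"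
    unfolding h_def subst3_hom[OF ring_hom_const_poly[OF ring_hom_C3] ring_hom_poly]
    by (simp add: add.commute)
  moreover have "F - subst3 C3 (\<lambda>i. Lin k * C3 (p i) + Lin l * C3 (u i)) F \<in> {F. Lin a dvd F}"
  proof (rule subst3_diff_in_ideal)
    show "X3 i - (Lin k * C3 (p i) + Lin l * C3 (u i)) \<in> {F. Lin a dvd F}" for i
      using X3_expansion[OF k, of i] by (simp add: p_def u_def)
  qed auto
  ultimately show ?thesis by simp
qed

subsection \<open>Forms modulo a general line\<close>

text \<open>Surjectivity of the fat point ideal in degree \<open>d\<close> onto the forms on the
  line \<open>l\<close>. The cofactor \<open>H\<close> carries no degree condition, since
  homogeneity follows from that of \<open>F\<close> and \<open>G\<close>.\<close>

definition surj_mod :: "(3 \<Rightarrow> 'k::field) \<Rightarrow> (3 \<Rightarrow> 'k) set \<Rightarrow> ((3 \<Rightarrow> 'k) \<Rightarrow> nat) \<Rightarrow> nat \<Rightarrow> bool" where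
  "surj_mod l V \<mu> d \<longleftrightarrow>
     (\<forall>F. homog F d \<longrightarrow> (\<exists>G H. homog G d \<and> (\<forall>v\<in>V. G \<in> J v (\<mu> v)) \<and> F = G + Lin l * H))"

lemma surj_mod_zero: "\<forall>v\<in>V. \<mu> v = 0 \<Longrightarrow> surj_mod l V \<mu> d"
  unfolding surj_mod_def by (metis J_0 add.right_neutral mult_zero_right)

lemma surj_mod_cong: "(\<And>v. v \<in> V \<Longrightarrow> \<mu> v = \<nu> v) \<Longrightarrow> surj_mod l V \<mu> d \<longleftrightarrow> surj_mod l V \<nu> d"
  unfolding surj_mod_def by simp

text \<open>Restricted to the line \<open>l\<close>, the multiples of \<open>a\<close> have codimension one, so besides the residual
  conditions it suffices to find one form in the ideal that does not vanish at the common point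
  of \<open>a\<close> and \<open>l\<close>; a product of lines serves.\<close>

lemma surj_mod_peel:
  assumes al: "cross a l \<noteq> (\<lambda>_. 0)" and len: "length bs \<le> Suc e"
    and nz: "\<And>b. b \<in> set bs \<Longrightarrow> dot b (cross a l) \<noteq> 0"
    and cnt: "\<And>v. v \<in> V \<Longrightarrow> \<mu> v \<le> length (filter (\<lambda>b. dot b v = 0) bs)"
    and res: "surj_mod l V (\<lambda>v. if dot a v = 0 then \<mu> v - 1 else \<mu> v) e"
  shows "surj_mod l V \<mu> (Suc e)"
  unfolding surj_mod_def
proof (intro allI impI)
  fix F :: "'a mpoly3"
  assume F: "homog F (Suc e)"
  obtain k where k: "dot k (cross a l) = 1" using exists_dot_1 al by blast
  let ?p = "cross a l"
  \<comment> \<open>Copies of \<open>k\<close> pad the product to the exact degree; \<open>k\<close>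
    has value 1 at the common point of \<open>a\<close> and \<open>l\<close>.\<close>
  define cs where "cs = bs @ replicate (Suc e - length bs) k"
  define G0 where "G0 = prod_list (map Lin cs)"
  have hom: "ring_hom (\<lambda>F. eval3 F ?p)"
    unfolding eval3_eq_subst3 by (intro ring_hom_subst3 ring_hom_id)
  have "length cs = Suc e" using len by (simp add: cs_def)
  then have G0_homog: "homog G0 (Suc e)" using homog_prod_Lin[of cs] by (simp add: G0_def)
  have G0_nz: "eval3 G0 ?p \<noteq> 0"
    unfolding G0_def eval3_prod_Lin using nz k by (auto simp: prod_list_zero_iff cs_def)
  have G0_J: "G0 \<in> J v (\<mu> v)" if "v \<in> V" for v
    unfolding G0_def
    by (rule J_antimono[OF prod_Lin_in_J]) (use cnt[OF that] in \<open>simp add: cs_def\<close>)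
  \<comment> \<open>The multiple of \<open>G0\<close> that agrees with \<open>F\<close> at the
    common point.\<close>
  define c where "c = eval3 F ?p / eval3 G0 ?p"
  have eval_C3: "eval3 (C3 x) ?p = x" for x
    by (simp add: eval3_eq_subst3 subst3_C3 ring_hom_id)
  have "homog (F - C3 c * G0) (Suc e)"
    using homog_diff[OF F homog_C3_mult[OF G0_homog]] .
  moreover have "eval3 (F - C3 c * G0) ?p = 0"
    using G0_nz by (simp add: ring_hom_simps[OF hom] eval_C3 c_def)
  ultimately obtain A B where A: "homog A e" and AB: "F - C3 c * G0 = Lin a * A + Lin l * B"
    using vanish_imp_in_two_lines[OF k] by blast
  obtain G1 H1 where G1: "homog G1 e" "\<forall>v\<in>V. G1 \<in> J v (if dot a v = 0 then \<mu> v - 1 else \<mu> v)"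
    and A_eq: "A = G1 + Lin l * H1"
    using res A unfolding surj_mod_def by blast
  have "Lin a * G1 \<in> J v (\<mu> v)" if v: "v \<in> V" for v
  proof (cases "dot a v = 0")
    case True
    then have "Lin a * G1 \<in> J v (1 + (\<mu> v - 1))"
      using G1(2) v by (intro J_mult J_Lin) auto
    then show ?thesis by (rule J_antimono) simp
  next
    case False
    then show ?thesis using G1(2) v by (intro J_mult_left) auto
  qed
  then have "\<forall>v\<in>V. C3 c * G0 + Lin a * G1 \<in> J v (\<mu> v)"
    by (blast intro: J_add J_mult_left G0_J)
  moreover have "homog (C3 c * G0 + Lin a * G1) (Suc e)"
    using homog_mult[OF homog_Lin G1(1)] by (intro homog_add homog_C3_mult G0_homog) simp
  moreover have "F = (C3 c * G0 + Lin a * G1) + Lin l * (Lin a * H1 + B)"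
    using AB unfolding A_eq by (simp add: algebra_simps)
  ultimately show "\<exists>G H. homog G (Suc e) \<and> (\<forall>v\<in>V. G \<in> J v (\<mu> v)) \<and> F = G + Lin l * H"
    by blast
qed

text \<open>Each step peels a line through one remaining point. The auxiliary product needs at most
  one line per remaining point, so the number of points may be as large as the degree.\<close>

lemma surj_mod_few_points:
  assumes "finite V" "\<And>v. v \<in> V \<Longrightarrow> dot l v \<noteq> 0" "card {v \<in> V. \<mu> v \<noteq> 0} \<le> d" "\<And>v. v \<in> V \<Longrightarrow> \<mu> v \<le> 1"
  shows "surj_mod l V \<mu> d"
  using assms(3,4)
proof (induction d arbitrary: \<mu>)
  case 0
  then show ?case using assms(1) by (intro surj_mod_zero) auto
next
  case (Suc d)
  let ?S = "{v \<in> V. \<mu> v \<noteq> 0}"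
  have fin: "finite ?S" using assms(1) by simp
  show ?case
  proof (cases "?S = {}")
    case True
    then show ?thesis by (intro surj_mod_zero) auto
  next
    case False
    then obtain q where q: "q \<in> V" "\<mu> q \<noteq> 0" by blast
    obtain a where a: "a \<noteq> (\<lambda>_. 0)" "dot a q = 0" using exists_line_through by blast
    have al: "cross a l \<noteq> (\<lambda>_. 0)" using cross_nonzero[OF a assms(2)[OF q(1)]] by simp
    have "\<forall>v\<in>?S. \<exists>b. dot b v = 0 \<and> dot b (cross a l) \<noteq> 0"
    proof
      fix v assume "v \<in> ?S"
      then have "cross v (cross a l) \<noteq> (\<lambda>_. 0)"
        using cross_nonzero(2)[OF al, of l v] assms(2)[of v] by (simp add: dot_commute)
      then show "\<exists>b. dot b v = 0 \<and> dot b (cross a l) \<noteq> 0"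
        by (rule exists_line_through_avoiding)
    qed
    then obtain b where b: "\<And>v. v \<in> ?S \<Longrightarrow> dot (b v) v = 0" "\<And>v. v \<in> ?S \<Longrightarrow> dot (b v) (cross a l) \<noteq> 0"
      using bchoice[of ?S "\<lambda>v b. dot b v = 0 \<and> dot b (cross a l) \<noteq> 0"] by blast
    obtain vs where vs: "set vs = ?S" "distinct vs" using finite_distinct_list[OF fin] by blast
    show ?thesis
    proof (rule surj_mod_peel[OF al, of "map b vs"])
      show "length (map b vs) \<le> Suc d" using Suc.prems(1) vs distinct_card by fastforce
      show "dot c (cross a l) \<noteq> 0" if "c \<in> set (map b vs)" for c using that b(2) vs(1) by auto
      show "\<mu> v \<le> length (filter (\<lambda>b. dot b v = 0) (map b vs))" if "v \<in> V" for v
      proof (cases "\<mu> v = 0")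
        case False
        then have "b v \<in> set (filter (\<lambda>b. dot b v = 0) (map b vs))" using b(1) vs(1) that by auto
        then have "length (filter (\<lambda>b. dot b v = 0) (map b vs)) > 0" by (rule length_pos_if_in_set)
        then show ?thesis using Suc.prems(2)[OF that] by linarith
      qed simp
      let ?\<nu> = "\<lambda>v. if dot a v = 0 then \<mu> v - 1 else \<mu> v"
      have "{v \<in> V. ?\<nu> v \<noteq> 0} \<subset> ?S" using q a Suc.prems(2)[of q] by (auto split: if_splits)
      then have "card {v \<in> V. ?\<nu> v \<noteq> 0} < card ?S" using fin psubset_card_mono by blast
      then show "surj_mod l V ?\<nu> d"
        using Suc.prems by (intro Suc.IH) (auto intro: le_trans[OF diff_le_self])
    qed
  qed
qed

text \<open>Gains one degree over \<open>surj_mod_few_points\<close>: the peeled line removes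
  \<open>q1\<close> and \<open>q2\<close> at once, and in the auxiliary product the single line
  \<open>b13\<close> serves both \<open>q1\<close> and \<open>q3\<close>. As \<open>q3\<close> is
  off \<open>a\<close>, the line \<open>b13\<close> meets \<open>a\<close> only in \<open>q1\<close>
  and misses the point where \<open>a\<close> meets \<open>l\<close>.\<close>

lemma surj_mod_noncollinear:
  assumes "finite V" "\<And>v. v \<in> V \<Longrightarrow> dot l v \<noteq> 0"
    and distinct: "\<And>v w. v \<in> V \<Longrightarrow> w \<in> V \<Longrightarrow> v \<noteq> w \<Longrightarrow> cross v w \<noteq> (\<lambda>_. 0)"
    and noncoll: "\<And>n. n \<noteq> (\<lambda>_. 0) \<Longrightarrow> \<exists>v\<in>V. \<mu> v \<noteq> 0 \<and> dot n v \<noteq> 0"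
    and card: "card {v \<in> V. \<mu> v \<noteq> 0} \<le> Suc d" and le: "\<And>v. v \<in> V \<Longrightarrow> \<mu> v \<le> 1"
  shows "surj_mod l V \<mu> d"
proof -
  let ?S = "{v \<in> V. \<mu> v \<noteq> 0}"
  have fin: "finite ?S" using assms(1) by simp
  \<comment> \<open>Any nonzero vector will do; it yields some point of positive
    multiplicity.\<close>
  obtain q1 where q1: "q1 \<in> V" "\<mu> q1 \<noteq> 0"
    using noncoll[of "\<lambda>_. 1"] by (auto simp: fun_eq_iff)
  obtain n where n: "n \<noteq> (\<lambda>_. 0)" "dot n q1 = 0" using exists_line_through by blast
  obtain q2 where q2: "q2 \<in> V" "\<mu> q2 \<noteq> 0" "dot n q2 \<noteq> 0" using noncoll[OF n(1)] by blast
  define a where "a = cross q1 q2"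
  have "q1 \<noteq> q2" using n q2 by auto
  then have a: "a \<noteq> (\<lambda>_. 0)" using distinct q1 q2 by (auto simp: a_def)
  have a12: "dot a q1 = 0" "dot a q2 = 0" by (simp_all add: a_def)
  obtain q3 where q3: "q3 \<in> V" "\<mu> q3 \<noteq> 0" "dot a q3 \<noteq> 0" using noncoll[OF a] by blast
  define b13 where "b13 = cross q1 q3"
  have "q3 \<noteq> q1" "q3 \<noteq> q2" using a12 q3 by auto
  have b13: "b13 \<noteq> (\<lambda>_. 0)" using distinct[OF q1(1) q3(1)] \<open>q3 \<noteq> q1\<close> by (auto simp: b13_def)
  have al: "cross a l \<noteq> (\<lambda>_. 0)" using cross_nonzero[OF a a12(1) assms(2)[OF q1(1)]] by simp
  have "card {q1, q2, q3} \<le> card ?S" using q1 q2 q3 fin by (intro card_mono) auto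
  then have "3 \<le> card ?S" using \<open>q1 \<noteq> q2\<close> \<open>q3 \<noteq> q1\<close> \<open>q3 \<noteq> q2\<close> by simp
  then obtain e where d: "d = Suc e" using card by (cases d) auto
  have "\<forall>v\<in>?S. \<exists>b. dot b v = 0 \<and> dot b (cross a l) \<noteq> 0"
  proof
    fix v assume "v \<in> ?S"
    then have "cross v (cross a l) \<noteq> (\<lambda>_. 0)"
      using cross_nonzero(2)[OF al, of l v] assms(2)[of v] by (simp add: dot_commute)
    then show "\<exists>b. dot b v = 0 \<and> dot b (cross a l) \<noteq> 0"
      by (rule exists_line_through_avoiding)
  qed
  then obtain b where b: "\<And>v. v \<in> ?S \<Longrightarrow> dot (b v) v = 0" "\<And>v. v \<in> ?S \<Longrightarrow> dot (b v) (cross a l) \<noteq> 0"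
    using bchoice[of ?S "\<lambda>v b. dot b v = 0 \<and> dot b (cross a l) \<noteq> 0"] by blast
  obtain vs where vs: "set vs = ?S - {q1, q3}" "distinct vs"
    using finite_distinct_list[of "?S - {q1, q3}"] fin by blast
  have "length vs = card (?S - {q1, q3})" using vs distinct_card by fastforce
  also have "\<dots> = card ?S - 2" 
    using q1 q3 \<open>q3 \<noteq> q1\<close> fin by (subst card_Diff_subset) auto
  finally have len: "length vs = card ?S - 2" .
  have "surj_mod l V \<mu> (Suc e)"
  proof (rule surj_mod_peel[OF al, of "b13 # map b vs"])
    show "length (b13 # map b vs) \<le> Suc e" using len card \<open>3 \<le> card ?S\<close> d by simp
    have "cross a b13 \<noteq> (\<lambda>_. 0)" using cross_nonzero(2)[OF b13, of q3 a] q3 by (simp add: b13_def)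
    then have "dot b13 (cross a l) \<noteq> 0"
      by (rule dot_cross_nonzero[of _ _ q1]) (use a12 assms(2) q1 in \<open>auto simp: b13_def\<close>)
    then show "dot c (cross a l) \<noteq> 0" if "c \<in> set (b13 # map b vs)" for c
      using that b(2) vs(1) by auto
    show "\<mu> v \<le> length (filter (\<lambda>b. dot b v = 0) (b13 # map b vs))" if "v \<in> V" for v
    proof (cases "\<mu> v = 0")
      case False
      then have "b13 \<in> set (filter (\<lambda>b. dot b v = 0) (b13 # map b vs)) \<or>
        b v \<in> set (filter (\<lambda>b. dot b v = 0) (b13 # map b vs))"
        using b(1) vs(1) that by (auto simp: b13_def)
      then have "length (filter (\<lambda>b. dot b v = 0) (b13 # map b vs)) > 0"
        by (elim disjE) (erule length_pos_if_in_set)+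
      then show ?thesis using le[OF that] by linarith
    qed simp
    let ?\<nu> = "\<lambda>v. if dot a v = 0 then \<mu> v - 1 else \<mu> v"
    have "{v \<in> V. ?\<nu> v \<noteq> 0} \<subseteq> ?S - {q1, q2}" using a12 le[of q1] le[of q2] by (auto split: if_splits)
    then have "card {v \<in> V. ?\<nu> v \<noteq> 0} \<le> card (?S - {q1, q2})" using fin by (intro card_mono) auto
    also have "\<dots> = card ?S - 2"
      using q1 q2 \<open>q1 \<noteq> q2\<close> fin by (subst card_Diff_subset) auto
    finally show "surj_mod l V ?\<nu> e"
      using assms(1,2) le card d by (intro surj_mod_few_points) (auto intro: le_trans[OF diff_le_self])
  qed
  then show ?thesis using d by simp
qed

subsection \<open>Star configurations with one further point on each line\<close>

text \<open>\<open>V\<close> and \<open>\<Lambda>\<close> hold one coordinate vector per point and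
  per line, and \<open>l\<close> is the general line to which forms are restricted. The further
  points appear as those with exactly one line of \<open>\<Lambda>\<close> through them.\<close>

locale star_points =
  fixes l :: "3 \<Rightarrow> 'k::field" and V \<Lambda> :: "(3 \<Rightarrow> 'k) set"
  assumes finite_V: "finite V" and finite_\<Lambda>: "finite \<Lambda>"
    and off: "v \<in> V \<Longrightarrow> dot l v \<noteq> 0"
    and V_distinct: "v \<in> V \<Longrightarrow> w \<in> V \<Longrightarrow> v \<noteq> w \<Longrightarrow> cross v w \<noteq> (\<lambda>_. 0)"
    and \<Lambda>_nonzero: "a \<in> \<Lambda> \<Longrightarrow> a \<noteq> (\<lambda>_. 0)"
    and \<Lambda>_distinct: "a \<in> \<Lambda> \<Longrightarrow> b \<in> \<Lambda> \<Longrightarrow> a \<noteq> b \<Longrightarrow> cross a b \<noteq> (\<lambda>_. 0)"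
    and one_or_two: "v \<in> V \<Longrightarrow> card {a \<in> \<Lambda>. dot a v = 0} = 1 \<or> card {a \<in> \<Lambda>. dot a v = 0} = 2"
    and meet: "a \<in> \<Lambda> \<Longrightarrow> b \<in> \<Lambda> \<Longrightarrow> a \<noteq> b \<Longrightarrow> \<exists>v\<in>V. dot a v = 0 \<and> dot b v = 0"
    and simple: "a \<in> \<Lambda> \<Longrightarrow> \<exists>!q. q \<in> V \<and> dot a q = 0 \<and> card {b \<in> \<Lambda>. dot b q = 0} = 1"
    and noncollinear: "n \<noteq> (\<lambda>_. 0) \<Longrightarrow> \<exists>q\<in>V. card {b \<in> \<Lambda>. dot b q = 0} = 1 \<and> dot n q \<noteq> 0"
begin

abbreviation through :: "(3 \<Rightarrow> 'k) \<Rightarrow> (3 \<Rightarrow> 'k) set" where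
  "through v \<equiv> {a \<in> \<Lambda>. dot a v = 0}"

text \<open>The map from a simple point to its line is injective, as no line has two such
  points.\<close>

lemma card_simple_points: "card {v \<in> V. card (through v) = 1} \<le> card \<Lambda>"
proof -
  have "\<forall>v\<in>{v \<in> V. card (through v) = 1}. \<exists>a. through v = {a}"
    by (auto simp: card_1_singleton_iff)
  then obtain f where f: "\<And>v. v \<in> V \<Longrightarrow> card (through v) = 1 \<Longrightarrow> through v = {f v}"
    using bchoice[of "{v \<in> V. card (through v) = 1}" "\<lambda>v a. through v = {a}"] by blast
  show ?thesis
  proof (rule card_inj_on_le[OF _ _ finite_\<Lambda>])
    have fv: "f v \<in> \<Lambda>" "dot (f v) v = 0" if "v \<in> V" "card (through v) = 1" for v
      using f[OF that] by blast+
    show "f ` {v \<in> V. card (through v) = 1} \<subseteq> \<Lambda>" using fv by auto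
    show "inj_on f {v \<in> V. card (through v) = 1}"
    proof (rule inj_onI)
      fix v w
      assume v: "v \<in> {v \<in> V. card (through v) = 1}" and w: "w \<in> {v \<in> V. card (through v) = 1}"
        and eq: "f v = f w"
      have "v \<in> V \<and> dot (f v) v = 0 \<and> card (through v) = 1"
        and "w \<in> V \<and> dot (f v) w = 0 \<and> card (through w) = 1"
        using v w fv[of v] fv[of w] eq by auto
      then show "v = w" using simple[of "f v"] fv(1)[of v] v by blast
    qed
  qed
qed

text \<open>The weight \<open>c a\<close> is the number of times the line \<open>a\<close> remains to be peeled off, plus one.\<close>

lemma surj_mod_weights:
  assumes "m \<ge> 2" "\<And>a. a \<in> \<Lambda> \<Longrightarrow> 1 \<le> c a \<and> c a < m"
  shows "surj_mod l V (\<lambda>v. sum c (through v) - m * (card (through v) - 1)) (sum c \<Lambda> - 1)"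
  using assms(2)
proof (induction "sum c \<Lambda>" arbitrary: c rule: less_induct)
  case less
  \<comment> \<open>On a single line \<open>a\<close> the value is \<open>c a\<close>; on two lines
    \<open>a\<close>, \<open>b\<close> it is \<open>c a + c b - m\<close>, cut off at 0. Weights
    \<open>m - 1\<close> give the residual multiplicities, and weights 1 leave multiplicity one at
    the simple points and zero elsewhere.\<close>
  let ?\<mu> = "\<lambda>v. sum c (through v) - m * (card (through v) - 1)"
  show ?case
  proof (cases "\<forall>a\<in>\<Lambda>. c a = 1")
    case True
    have sum_through: "sum c (through v) = card (through v)" for v
      using True by (simp add: sum.cong[of _ "through v" c "\<lambda>_. 1"])
    have \<mu>: "?\<mu> v = (if card (through v) = 1 then 1 else 0)" if "v \<in> V" for v
      using one_or_two[OF that] assms(1) unfolding sum_through by auto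
    moreover have "surj_mod l V (\<lambda>v. if card (through v) = 1 then 1 else 0) (card \<Lambda> - 1)"
    proof (rule surj_mod_noncollinear[OF finite_V off V_distinct])
      show "\<exists>v\<in>V. (if card (through v) = 1 then 1 else 0) \<noteq> (0::nat) \<and> dot n v \<noteq> 0"
        if n: "n \<noteq> (\<lambda>_. 0)" for n
      proof -
        obtain q where "q \<in> V" "card (through q) = 1" "dot n q \<noteq> 0" using noncollinear[OF n] by blast
        then show ?thesis by (intro bexI[of _ q]) auto
      qed
      have "{v \<in> V. (if card (through v) = 1 then 1 else 0) \<noteq> (0::nat)} = {v \<in> V. card (through v) = 1}"
        by auto
      then show "card {v \<in> V. (if card (through v) = 1 then 1 else 0) \<noteq> (0::nat)} \<le> Suc (card \<Lambda> - 1)"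
        using card_simple_points by simp
    qed auto
    moreover have "sum c \<Lambda> = card \<Lambda>" using True by (simp add: sum.cong[of _ \<Lambda> c "\<lambda>_. 1"])
    ultimately show ?thesis
      using surj_mod_cong[of V ?\<mu> "\<lambda>v. if card (through v) = 1 then 1 else 0"] by simp
  next
    case False
    then obtain k where k: "k \<in> \<Lambda>" "2 \<le> c k" using less.prems by force
    obtain qk where qk: "qk \<in> V" "dot k qk = 0" "card (through qk) = 1" using simple[OF k(1)] by blast
    obtain qi where qi: "qi \<in> V" "card (through qi) = 1" "dot k qi \<noteq> 0"
      using noncollinear[OF \<Lambda>_nonzero[OF k(1)]] by blast
    obtain i where i: "through qi = {i}" using qi(2) card_1_singletonE by blast
    then have i_in: "i \<in> \<Lambda>" "dot i qi = 0" by auto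
    have "i \<noteq> k" using i_in qi by auto
    \<comment> \<open>Replaces \<open>k\<close> as a factor, since \<open>k\<close> vanishes where
      it meets \<open>l\<close>. Passing also through \<open>qi\<close>, it allows one factor
      \<open>i\<close> to be dropped.\<close>
    define b0 where "b0 = cross qi qk"
    have "b0 \<noteq> (\<lambda>_. 0)" using V_distinct[OF qi(1) qk(1)] qi qk by (auto simp: b0_def)
    then have kb0: "cross k b0 \<noteq> (\<lambda>_. 0)"
      using cross_nonzero(2)[of b0 qi k] qi(3) by (simp add: b0_def)
    \<comment> \<open>Exponents of the lines in the auxiliary product. Together with
      \<open>c k\<close> copies of \<open>b0\<close> the degree becomes
      \<open>sum c \<Lambda> - 1\<close>, exactly the one available.\<close>
    define e where "e a = (if a = k then 0 else if a = i then c a - 1 else c a)" for a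
    obtain as where as: "set as = \<Lambda>" "distinct as" using finite_distinct_list[OF finite_\<Lambda>] by blast
    define bs where "bs = concat (map (\<lambda>a. replicate (e a) a) as) @ replicate (c k) b0"
    have kl: "cross k l \<noteq> (\<lambda>_. 0)"
      using cross_nonzero(1)[OF \<Lambda>_nonzero[OF k(1)] qk(2) off[OF qk(1)]] .
    have split: "sum f \<Lambda> = f k + f i + sum f (\<Lambda> - {k, i})" for f :: "_ \<Rightarrow> nat"
      using k(1) i_in(1) \<open>i \<noteq> k\<close> finite_\<Lambda>
      by (simp add: sum.remove[of \<Lambda> k] sum.remove[of "\<Lambda> - {k}" i] Diff_insert2[symmetric] insert_commute)
    have "sum e (\<Lambda> - {k, i}) = sum c (\<Lambda> - {k, i})"
      by (rule sum.cong) (auto simp: e_def)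
    then have sum_e: "sum e \<Lambda> + c k = sum c \<Lambda> - 1"
      using split[of e] split[of c] less.prems[OF i_in(1)] \<open>i \<noteq> k\<close> by (simp add: e_def)
    have "length (concat (map (\<lambda>a. replicate (e a) a) as)) = sum e \<Lambda>"
      using as by (simp add: length_concat comp_def sum_list_distinct_conv_sum_set)
    then have len: "length bs = sum c \<Lambda> - 1" using sum_e by (simp add: bs_def)
    have filt: "length (filter (\<lambda>b. dot b v = 0) bs) = sum e (through v) + (if dot b0 v = 0 then c k else 0)" for v
    proof -
      have "length (filter (\<lambda>b. dot b v = 0) (concat (map (\<lambda>a. replicate (e a) a) xs))) =
          (\<Sum>a\<leftarrow>xs. if dot a v = 0 then e a else 0)" for xs
        by (induction xs) auto
      then have "length (filter (\<lambda>b. dot b v = 0) (concat (map (\<lambda>a. replicate (e a) a) as))) =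
          (\<Sum>a\<in>\<Lambda>. if dot a v = 0 then e a else 0)"
        using as by (simp add: sum_list_distinct_conv_sum_set)
      also have "\<dots> = sum e (through v)"
        using finite_\<Lambda> by (simp add: sum.inter_filter)
      finally show ?thesis by (simp add: bs_def)
    qed
    let ?c = "c(k := c k - 1)"
    let ?\<nu> = "\<lambda>v. sum ?c (through v) - m * (card (through v) - 1)"
    have sum_c: "sum c A = Suc (sum ?c A)" if "k \<in> A" "finite A" for A
      using that k(2) by (simp add: sum.remove[of A k])
    have sum_c': "sum ?c A = sum c A" if "k \<notin> A" for A
      using that by (intro sum.cong) auto
    have "surj_mod l V ?\<nu> (sum ?c \<Lambda> - 1)"
      using less.prems k sum_c[OF k(1) finite_\<Lambda>] by (intro less.hyps) (auto simp: less_imp_diff_less)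
    moreover have "?\<nu> v = (if dot k v = 0 then ?\<mu> v - 1 else ?\<mu> v)" for v
      using sum_c[of "through v"] sum_c'[of "through v"] k(1) finite_\<Lambda> by auto
    ultimately have IH: "surj_mod l V (\<lambda>v. if dot k v = 0 then ?\<mu> v - 1 else ?\<mu> v) (sum ?c \<Lambda> - 1)"
      by simp
    \<comment> \<open>Hence the sum is at least 3, and the subtractions in the degrees are not
      truncated.\<close>
    have ge: "c k + c i \<le> sum c \<Lambda>" using split[of c] by simp
    have "surj_mod l V ?\<mu> (Suc (sum ?c \<Lambda> - 1))"
    proof (rule surj_mod_peel[OF kl _ _ _ IH, of bs])
      show "length bs \<le> Suc (sum ?c \<Lambda> - 1)"
        using len sum_c[OF k(1) finite_\<Lambda>] by simp
      show "dot b (cross k l) \<noteq> 0" if "b \<in> set bs" for b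
      proof -
        have "b = b0 \<or> b \<in> \<Lambda> \<and> e b \<noteq> 0" using that as(1) by (auto simp: bs_def)
        then show ?thesis
        proof
          assume "b = b0"
          then show ?thesis using dot_cross_nonzero[OF kb0 qk(2) _ off[OF qk(1)]] by (simp add: b0_def)
        next
          assume b: "b \<in> \<Lambda> \<and> e b \<noteq> 0"
          then have "k \<noteq> b" by (auto simp: e_def)
          then obtain v where "v \<in> V" "dot k v = 0" "dot b v = 0" using meet[OF k(1)] b by blast
          then show ?thesis using dot_cross_nonzero[OF \<Lambda>_distinct[OF k(1) _ \<open>k \<noteq> b\<close>]] off b by blast
        qed
      qed
      fix v assume v: "v \<in> V"
      show "?\<mu> v \<le> length (filter (\<lambda>b. dot b v = 0) bs)"
        unfolding filt
      proof (cases "card (through v) = 1")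
        case True
        then obtain a where a: "through v = {a}" using card_1_singletonE by blast
        then have "a \<in> \<Lambda>" "dot a v = 0" by auto
        \<comment> \<open>At the simple points of \<open>k\<close> and \<open>i\<close> the
          \<open>c k\<close> copies of \<open>b0\<close> make up for the missing factors.\<close>
        have "dot b0 v = 0" if "a = k \<or> a = i"
        proof -
          have "v = qk \<or> v = qi"
            using that simple[OF \<open>a \<in> \<Lambda>\<close>] v True \<open>dot a v = 0\<close> qk qi i_in by blast
          then show ?thesis by (auto simp: b0_def)
        qed
        then show "?\<mu> v \<le> sum e (through v) + (if dot b0 v = 0 then c k else 0)"
          using k(2) unfolding a by (auto simp: e_def)
      next
        case False
        then have "card (through v) = 2" using one_or_two[OF v] by blast
        then obtain a b where ab: "through v = {a, b}" "a \<noteq> b" by (auto simp: card_2_iff)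
        then have "a \<in> \<Lambda>" "b \<in> \<Lambda>" by auto
        \<comment> \<open>The factors lost on \<open>k\<close> and \<open>i\<close> together number
          \<open>c k + 1 \<le> m\<close>, which the subtraction of \<open>m\<close> absorbs.\<close>
        have "c a + c b - m \<le> e a + e b"
          using less.prems[OF \<open>a \<in> \<Lambda>\<close>] less.prems[OF \<open>b \<in> \<Lambda>\<close>] assms(1) \<open>a \<noteq> b\<close> by (auto simp: e_def)
        then show "?\<mu> v \<le> sum e (through v) + (if dot b0 v = 0 then c k else 0)"
          using ab by simp
      qed
    qed
    moreover have "Suc (sum ?c \<Lambda> - 1) = sum c \<Lambda> - 1"
      using sum_c[OF k(1) finite_\<Lambda>] ge k(2) less.prems[OF i_in(1)] by simp
    ultimately show ?thesis by (simp only:)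
  qed
qed

text \<open>All weights are \<open>m - 1\<close>: at a point on \<open>r\<close> lines,
  \<open>(m - 1) r - m (r - 1) = m - r\<close>.\<close>

lemma surj_mod_residual:
  assumes "m \<ge> 2"
  shows "surj_mod l V (\<lambda>v. m - card (through v)) (card \<Lambda> * (m - 1) - 1)"
proof -
  have "surj_mod l V (\<lambda>v. (\<Sum>a\<in>through v. m - 1) - m * (card (through v) - 1)) ((\<Sum>a\<in>\<Lambda>. m - 1) - 1)"
    using assms by (intro surj_mod_weights) auto
  moreover have "(\<Sum>a\<in>through v. m - 1) - m * (card (through v) - 1) = m - card (through v)" if "v \<in> V" for v
    using one_or_two[OF that] by auto
  ultimately show ?thesis
    using surj_mod_cong[of V "\<lambda>v. (\<Sum>a\<in>through v. m - 1) - m * (card (through v) - 1)"] by simp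
qed

end

subsection \<open>Dimensions\<close>

text \<open>The space of all polynomials is infinite-dimensional, so finiteness comes from the
  common finite spanning set \<open>W\<close>. Bases of \<open>A\<close> and \<open>B\<close> are
  extended from a common basis \<open>D\<close> of the intersection.\<close>

lemma (in vector_space) dim_sums_Int_of_finite:
  assumes A: "subspace A" "A \<subseteq> span W" and B: "subspace B" "B \<subseteq> span W" and W: "finite W"
  shows "dim {x + y | x y. x \<in> A \<and> y \<in> B} + dim (A \<inter> B) = dim A + dim B"
proof -
  obtain D where D: "D \<subseteq> A \<inter> B" "independent D" "A \<inter> B \<subseteq> span D"
    by (rule maximal_independent_subset)
  obtain DA where DA: "D \<subseteq> DA" "DA \<subseteq> A" "independent DA" "A \<subseteq> span DA"
    using maximal_independent_subset_extend[of D A] D by blast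
  obtain DB where DB: "D \<subseteq> DB" "DB \<subseteq> B" "independent DB" "B \<subseteq> span DB"
    using maximal_independent_subset_extend[of D B] D by blast
  have fin: "finite DA" "finite DB"
    using independent_span_bound[OF W DA(3)] independent_span_bound[OF W DB(3)] DA DB A B by auto
  then have finD: "finite D" using DA finite_subset by blast
  define E where "E = DB - D"
  have disj: "DA \<inter> E = {}"
  proof (rule ccontr)
    assume "DA \<inter> E \<noteq> {}"
    then obtain x where x: "x \<in> DA" "x \<in> DB" "x \<notin> D" unfolding E_def by blast
    then have "x \<in> span D" using D DA DB by blast
    then have "x \<in> span (DB - {x})" using span_mono[of D "DB - {x}"] x DB by blast
    then show False using DB(3) x unfolding dependent_def by blast
  qed
  have indep: "independent (DA \<union> E)"
  proof (rule independent_if_scalars_zero)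
    show "finite (DA \<union> E)" using fin by (simp add: E_def)
    fix f x assume sum: "(\<Sum>x\<in>DA \<union> E. f x *s x) = 0" and x: "x \<in> DA \<union> E"
    have split: "(\<Sum>x\<in>DA. f x *s x) + (\<Sum>x\<in>E. f x *s x) = 0"
      using sum disj fin by (simp add: sum.union_disjoint E_def)
    let ?w = "\<Sum>x\<in>E. f x *s x"
    \<comment> \<open>The part over \<open>E\<close> lies in both \<open>A\<close> and
      \<open>B\<close>, hence in \<open>span D\<close>; the resulting relation over
      \<open>DB\<close> forces its coefficients to vanish.\<close>
    have "?w \<in> B" using DB B by (intro subspace_sum subspace_scale) (auto simp: E_def)
    have "(\<Sum>x\<in>DA. f x *s x) \<in> A" using DA A by (intro subspace_sum subspace_scale) auto
    moreover have "?w = - (\<Sum>x\<in>DA. f x *s x)" using split by (simp only: add_eq_0_iff)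
    ultimately have "?w \<in> A" using subspace_neg[OF A(1)] by simp
    then have "?w \<in> span D" using D \<open>?w \<in> B\<close> by blast
    then obtain g where g: "?w = (\<Sum>x\<in>D. g x *s x)"
      using span_finite[OF finD] by auto
    have zero: "(\<Sum>x\<in>DB. (if x \<in> D then - g x else f x) *s x) = 0"
    proof -
      have "(\<Sum>x\<in>DB. (if x \<in> D then - g x else f x) *s x) =
        (\<Sum>x\<in>D. (if x \<in> D then - g x else f x) *s x) + (\<Sum>x\<in>E. (if x \<in> D then - g x else f x) *s x)"
        unfolding E_def using DB(1) fin(2) by (simp add: sum.subset_diff[of D DB] add.commute)
      also have "(\<Sum>x\<in>D. (if x \<in> D then - g x else f x) *s x) = - (\<Sum>x\<in>D. g x *s x)"
        by (simp add: sum_negf)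
      also have "(\<Sum>x\<in>E. (if x \<in> D then - g x else f x) *s x) = ?w"
        by (rule sum.cong) (auto simp: E_def)
      finally show ?thesis using g by simp
    qed
    have fE: "f y = 0" if "y \<in> E" for y
      using independentD[OF DB(3) fin(2) subset_refl zero, of y] that by (auto simp: E_def)
    then have "?w = 0" by simp
    then have "(\<Sum>x\<in>DA. f x *s x) = 0" using split by simp
    then have "f y = 0" if "y \<in> DA" for y
      using independentD[OF DA(3) fin(1) subset_refl] that by blast
    then show "f x = 0" using fE x by blast
  qed
  have spanA: "span DA = A" using DA A by (simp add: span_subspace)
  have spanB: "span DB = B" using DB B by (simp add: span_subspace)
  have "DA \<union> DB = DA \<union> E" using DA(1) by (auto simp: E_def)
  then have "span (DA \<union> E) = {x + y | x y. x \<in> A \<and> y \<in> B}"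
    using span_Un[of DA DB] by (simp add: spanA spanB)
  then have "dim {x + y | x y. x \<in> A \<and> y \<in> B} = card (DA \<union> E)"
    using dim_span_eq_card_independent[OF indep] by simp
  also have "\<dots> = card DA + card E" using disj fin by (simp add: card_Un_disjoint E_def)
  finally have "dim {x + y | x y. x \<in> A \<and> y \<in> B} + card D = card DA + card DB"
    using DB(1) finD card_mono[OF fin(2) DB(1)] by (simp add: E_def card_Diff_subset)
  moreover have "dim (A \<inter> B) = card D" using basis_card_eq_dim[OF D(1) D(3) D(2)] by simp
  moreover have "dim A = card DA" "dim B = card DB"
    using dim_span_eq_card_independent[OF DA(3)] dim_span_eq_card_independent[OF DB(3)] spanA spanB by simp_all
  ultimately show ?thesis by simp
qed

interpretation pscale: vector_space "pscale :: 'k::field \<Rightarrow> 'k mpoly3 \<Rightarrow> 'k mpoly3"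
  by standard (simp_all add: pscale_def algebra_simps single_add mult_single flip: mult.assoc)

lemma dim_mult_image:
  fixes P :: "'k::field mpoly3"
  assumes "P \<noteq> 0" shows "pscale.dim ((*) P ` S) = pscale.dim S"
proof -
  have lin: "Vector_Spaces.linear pscale pscale ((*) P)"
    unfolding Vector_Spaces.linear_iff using pscale.vector_space_axioms
    by (simp add: pscale_def algebra_simps)
  interpret f: Vector_Spaces.linear pscale pscale "(*) P" by (rule lin)
  have inj: "inj_on ((*) P) A" for A using assms by (auto simp: inj_on_def)
  obtain B where B: "B \<subseteq> S" "pscale.independent B" "S \<subseteq> pscale.span B" "card B = pscale.dim S"
    by (rule pscale.basis_exists)
  show ?thesis
  proof (rule pscale.dim_unique)
    show "(*) P ` B \<subseteq> (*) P ` S" using B by blast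
    show "(*) P ` S \<subseteq> pscale.span ((*) P ` B)" using B f.span_image[of B] by blast
    show "pscale.independent ((*) P ` B)" by (rule f.independent_injective_image[OF B(2) inj])
    show "card ((*) P ` B) = pscale.dim S" using B(4) card_image[OF inj] by simp
  qed
qed

section \<open>Graded pieces of the polynomial ring and of fat point ideals\<close>

definition forms :: "nat \<Rightarrow> 'k::field mpoly3 set" where
  "forms d = {F. homog F d}"

definition monomials :: "nat \<Rightarrow> (3 \<Rightarrow>\<^sub>0 nat) set" where
  "monomials d = {\<mu>. mdeg \<mu> = d}"

lemma mdeg_add: "mdeg (\<mu> + \<nu>) = mdeg \<mu> + mdeg \<nu>"
  by (simp add: mdeg_def lookup_add sum.distrib)

lemma mdeg_single: "mdeg (Poly_Mapping.single i n) = n"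
  using cases_3[of i] by (auto simp: mdeg_def sum_3 lookup_single)

lemma monomials_0: "monomials 0 = {0}"
proof -
  have "\<mu> = 0" if "mdeg \<mu> = 0" for \<mu> :: "3 \<Rightarrow>\<^sub>0 nat"
    using that by (intro poly_mapping_eqI) (auto simp: mdeg_def)
  then show ?thesis by (auto simp: monomials_def mdeg_def)
qed

text \<open>Splits by divisibility by the variable 0. The monomials in the other two variables are
  the forms that survive on a line, and there are \<open>d + 2\<close> of them.\<close>

lemma monomials_Suc:
  "monomials (Suc d) = (\<lambda>\<mu>. \<mu> + Poly_Mapping.single 0 1) ` monomials d \<union>
     (\<lambda>j. Poly_Mapping.single 1 j + Poly_Mapping.single 2 (Suc d - j)) ` {..Suc d}"
proof (intro equalityI subsetI)
  fix \<mu> :: "3 \<Rightarrow>\<^sub>0 nat" assume \<mu>: "\<mu> \<in> monomials (Suc d)"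
  let ?x = "Poly_Mapping.lookup \<mu>"
  have deg: "?x 0 + ?x 1 + ?x 2 = Suc d" using \<mu> by (simp add: monomials_def mdeg_def sum_3)
  show "\<mu> \<in> (\<lambda>\<mu>. \<mu> + Poly_Mapping.single 0 1) ` monomials d \<union>
     (\<lambda>j. Poly_Mapping.single 1 j + Poly_Mapping.single 2 (Suc d - j)) ` {..Suc d}"
  proof (cases "?x 0")
    case 0
    then have "?x 2 = Suc d - ?x 1" using deg by simp
    then have "\<mu> = Poly_Mapping.single 1 (?x 1) + Poly_Mapping.single 2 (Suc d - ?x 1)"
      using poly_mapping_3[of \<mu>] 0 by simp
    moreover have "?x 1 \<le> Suc d" using deg by simp
    ultimately show ?thesis by blast
  next
    case (Suc n)
    let ?\<nu> = "Poly_Mapping.single 0 n + Poly_Mapping.single 1 (?x 1) + Poly_Mapping.single 2 (?x 2)"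
    have "\<mu> = ?\<nu> + Poly_Mapping.single 0 1"
      using poly_mapping_3[of \<mu>] single_add[of "0::3" n 1] Suc by (simp add: ac_simps)
    moreover have "?\<nu> \<in> monomials d" using deg Suc by (simp add: monomials_def mdeg_add mdeg_single)
    ultimately show ?thesis by blast
  qed
qed (auto simp: monomials_def mdeg_add mdeg_single)

lemma finite_monomials: "finite (monomials d)"
  by (induction d) (simp_all add: monomials_0 monomials_Suc)

lemma card_monomials_Suc: "card (monomials (Suc d)) = card (monomials d) + (d + 2)"
proof -
  let ?f = "\<lambda>\<mu> :: 3 \<Rightarrow>\<^sub>0 nat. \<mu> + Poly_Mapping.single 0 1"
  let ?g = "\<lambda>j. Poly_Mapping.single (1::3) j + Poly_Mapping.single 2 (Suc d - j)"
  have "inj_on ?f (monomials d)" by (auto simp: inj_on_def)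
  then have f: "card (?f ` monomials d) = card (monomials d)" by (rule card_image)
  have lg: "Poly_Mapping.lookup (?g j) 1 = j" "Poly_Mapping.lookup (?g j) 0 = 0" for j
    by (simp_all add: lookup_add lookup_single)
  have "inj_on ?g {..Suc d}" by (rule inj_on_inverseI[of _ "\<lambda>\<mu>. Poly_Mapping.lookup \<mu> 1"]) (rule lg)
  then have g: "card (?g ` {..Suc d}) = d + 2" by (simp add: card_image)
  have "Poly_Mapping.lookup (?f \<mu>) 0 \<noteq> 0" for \<mu> by (simp add: lookup_add)
  then have "?f \<mu> \<noteq> ?g j" for \<mu> j using lg(2)[of j] by metis
  then have "?f ` monomials d \<inter> ?g ` {..Suc d} = {}" by blast
  then show ?thesis
    unfolding monomials_Suc using f g finite_monomials[of d] by (subst card_Un_disjoint) auto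
qed

definition monomial_forms :: "nat \<Rightarrow> 'k::field mpoly3 set" where
  "monomial_forms d = (\<lambda>\<mu>. Poly_Mapping.single \<mu> 1) ` monomials d"

lemma inj_single_1: "inj_on (\<lambda>\<mu>. Poly_Mapping.single \<mu> (1::'k::field)) A"
  by (rule inj_onI) (metis lookup_single_eq lookup_single_not_eq zero_neq_one)

lemma forms_subset_span: "forms d \<subseteq> pscale.span (monomial_forms d)"
proof
  fix F :: "'a mpoly3" assume "F \<in> forms d"
  then have keys: "Poly_Mapping.keys F \<subseteq> monomials d" by (auto simp: forms_def homog_def monomials_def)
  have "F = (\<Sum>\<mu>\<in>Poly_Mapping.keys F. Poly_Mapping.single \<mu> (Poly_Mapping.lookup F \<mu>))"
    using subst3_ident[of F] by (simp add: subst3_def C3_prod_X3)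
  also have "\<dots> = (\<Sum>\<mu>\<in>Poly_Mapping.keys F. pscale (Poly_Mapping.lookup F \<mu>) (Poly_Mapping.single \<mu> 1))"
    by (simp add: pscale_def mult_single)
  also have "\<dots> \<in> pscale.span (monomial_forms d)"
    using keys by (intro pscale.span_sum pscale.span_scale pscale.span_base) (auto simp: monomial_forms_def)
  finally show "F \<in> pscale.span (monomial_forms d)" .
qed

lemma finite_monomial_forms: "finite (monomial_forms d)"
  by (simp add: monomial_forms_def finite_monomials)

lemma dim_forms: "pscale.dim (forms d :: 'k::field mpoly3 set) = card (monomials d)"
proof (rule pscale.dim_unique)
  show "monomial_forms d \<subseteq> (forms d :: 'k mpoly3 set)"
    by (auto simp: monomial_forms_def forms_def homog_def monomials_def)
  show "forms d \<subseteq> pscale.span (monomial_forms d :: 'k mpoly3 set)" by (rule forms_subset_span)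
  show "card (monomial_forms d :: 'k mpoly3 set) = card (monomials d)"
    unfolding monomial_forms_def by (rule card_image[OF inj_single_1])
  show "pscale.independent (monomial_forms d :: 'k mpoly3 set)"
  proof (rule pscale.independent_if_scalars_zero[OF finite_monomial_forms])
    fix f :: "'k mpoly3 \<Rightarrow> 'k" and x :: "'k mpoly3"
    assume sum: "(\<Sum>x\<in>monomial_forms d. pscale (f x) x) = 0" and "x \<in> monomial_forms d"
    then obtain \<mu> where \<mu>: "\<mu> \<in> monomials d" "x = Poly_Mapping.single \<mu> 1"
      by (auto simp: monomial_forms_def)
    have "0 = Poly_Mapping.lookup (\<Sum>x\<in>(monomial_forms d :: 'k mpoly3 set). pscale (f x) x) \<mu>" by (simp add: sum)
    also have "\<dots> = (\<Sum>\<nu>\<in>monomials d. Poly_Mapping.lookup (pscale (f (Poly_Mapping.single \<nu> 1)) (Poly_Mapping.single \<nu> 1)) \<mu>)"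
      unfolding monomial_forms_def by (simp add: sum.reindex[OF inj_single_1] lookup_sum)
    also have "\<dots> = (\<Sum>\<nu>\<in>monomials d. if \<nu> = \<mu> then f (Poly_Mapping.single \<nu> 1) else 0)"
      by (rule sum.cong) (auto simp: pscale_def mult_single lookup_single when_def)
    also have "\<dots> = f x" using \<mu> finite_monomials by simp
    finally show "f x = 0" by simp
  qed
qed

lemma subspace_forms: "pscale.subspace (forms d)"
  by (auto simp: pscale.subspace_def forms_def pscale_def homog_zero homog_add homog_C3_mult)

lemma subspace_fat_forms: "pscale.subspace {F. homog F d \<and> (\<forall>v\<in>V. F \<in> J v (\<mu> v))}"
  by (auto simp: pscale.subspace_def pscale_def homog_zero homog_add homog_C3_mult J_zero J_add J_mult_left)

text \<open>Exactness: the kernel of restriction to \<open>l\<close> in degree \<open>Suc d\<close>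
  is \<open>Lin l\<close> times the ideal in degree \<open>d\<close>, because \<open>l\<close>
  misses the points and dividing by it keeps all multiplicities. The image is everything by
  \<open>surj\<close>, and forms of degree \<open>Suc d\<close> on a line have dimension
  \<open>d + 2\<close>.\<close>

lemma dim_fat_forms_Suc:
  fixes l :: "3 \<Rightarrow> 'k::field"
  assumes surj: "surj_mod l V \<mu> (Suc d)" and off: "\<And>v. v \<in> V \<Longrightarrow> dot l v \<noteq> 0" and l: "l \<noteq> (\<lambda>_. 0)"
  shows "pscale.dim {F. homog F (Suc d) \<and> (\<forall>v\<in>V. F \<in> J v (\<mu> v))} =
    pscale.dim {F. homog F d \<and> (\<forall>v\<in>V. F \<in> J v (\<mu> v))} + (d + 2)"
proof -
  let ?S = "\<lambda>d. {F. homog F d \<and> (\<forall>v\<in>V. F \<in> J v (\<mu> v))}"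
  let ?B = "(*) (Lin l) ` forms d"
  have L: "Lin l \<noteq> 0" using l by (simp add: Lin_eq_0_iff)
  have homog_L: "homog (Lin l * F) (Suc d)" if "homog F d" for F
    using homog_mult[OF homog_Lin that] by simp
  have sub_B: "pscale.subspace ?B"
    unfolding pscale.subspace_def
  proof (intro conjI ballI allI)
    show "0 \<in> ?B" using pscale.subspace_0[OF subspace_forms, of d] by force
    fix x y c assume "x \<in> ?B"
    then obtain F where F: "x = Lin l * F" "F \<in> forms d" by blast
    have "pscale c x = Lin l * pscale c F" by (simp add: F pscale_def ac_simps)
    then show "pscale c x \<in> ?B" using pscale.subspace_scale[OF subspace_forms F(2)] by blast
    assume "y \<in> ?B"
    then obtain G where G: "y = Lin l * G" "G \<in> forms d" by blast
    have "x + y = Lin l * (F + G)" by (simp add: F G distrib_left)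
    then show "x + y \<in> ?B" using pscale.subspace_add[OF subspace_forms F(2) G(2)] by blast
  qed
  have sums: "{x + y | x y. x \<in> ?S (Suc d) \<and> y \<in> ?B} = forms (Suc d)"
  proof (intro equalityI subsetI)
    fix F assume "F \<in> {x + y | x y. x \<in> ?S (Suc d) \<and> y \<in> ?B}"
    then show "F \<in> forms (Suc d)" by (auto simp: forms_def intro!: homog_add homog_L)
  next
    fix F :: "'k mpoly3" assume "F \<in> forms (Suc d)"
    then have F: "homog F (Suc d)" by (simp add: forms_def)
    then obtain G H where GH: "homog G (Suc d)" "\<forall>v\<in>V. G \<in> J v (\<mu> v)" "F = G + Lin l * H"
      using surj unfolding surj_mod_def by blast
    then have "homog (Lin l * H) (Suc d)" using homog_diff[OF F GH(1)] by simp
    then have "homog H d" using homog_Lin_mult_imp l by blast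
    then show "F \<in> {x + y | x y. x \<in> ?S (Suc d) \<and> y \<in> ?B}" using GH by (auto simp: forms_def)
  qed
  have inter: "?S (Suc d) \<inter> ?B = (*) (Lin l) ` ?S d"
  proof (intro equalityI subsetI)
    fix F assume "F \<in> ?S (Suc d) \<inter> ?B"
    then obtain G where G: "F = Lin l * G" "homog G d" "\<forall>v\<in>V. Lin l * G \<in> J v (\<mu> v)"
      by (auto simp: forms_def)
    have "G \<in> J v (\<mu> v)" if "v \<in> V" for v
    proof (rule J_Lin_mult_imp_nonvanishing)
      show "dot l v \<noteq> 0" by (rule off[OF that])
      then show "v \<noteq> (\<lambda>_. 0)" by (auto simp: dot_def)
      show "Lin l * G \<in> J v (\<mu> v)" using G that by blast
    qed
    then show "F \<in> (*) (Lin l) ` ?S d" using G by blast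
  qed (auto simp: forms_def homog_L J_mult_left)
  let ?W = "monomial_forms (Suc d) :: 'k mpoly3 set"
  have "?S (Suc d) \<subseteq> forms (Suc d)" "?B \<subseteq> forms (Suc d)" by (auto simp: forms_def homog_L)
  then have "?S (Suc d) \<subseteq> pscale.span ?W" "?B \<subseteq> pscale.span ?W" using forms_subset_span by blast+
  from pscale.dim_sums_Int_of_finite[OF subspace_fat_forms this(1) sub_B this(2) finite_monomial_forms]
  have "pscale.dim (forms (Suc d) :: 'k mpoly3 set) + pscale.dim (?S d) =
      pscale.dim (?S (Suc d)) + pscale.dim (forms d :: 'k mpoly3 set)"
    unfolding sums inter dim_mult_image[OF L] .
  then show ?thesis unfolding dim_forms card_monomials_Suc by simp
qed

subsection \<open>Incidences of the points and lines\<close>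

lemma cross_eq_0_imp_multiple:
  fixes v w :: "3 \<Rightarrow> 'k::field"
  assumes "v \<noteq> (\<lambda>_. 0)" "w \<noteq> (\<lambda>_. 0)" "cross v w = (\<lambda>_. 0)"
  shows "\<exists>c. c \<noteq> 0 \<and> v = (\<lambda>i. c * w i)"
proof -
  obtain k where k: "dot k w = 1" using exists_dot_1 assms(2) by blast
  have eqs: "v 1 * w 2 = v 2 * w 1" "v 2 * w 0 = v 0 * w 2" "v 0 * w 1 = v 1 * w 0"
    using assms(3) by (auto simp: fun_eq_3 cross_simps)
  have "v i * w j = v j * w i" for i j
    using cases_3[of i] cases_3[of j] eqs by auto
  then have "v i * dot k w = dot k v * w i" for i
    by (simp add: dot_def sum_distrib_left sum_distrib_right ac_simps)
  then have "v = (\<lambda>i. dot k v * w i)" using k by auto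
  moreover have "dot k v \<noteq> 0" using calculation assms(1) by auto
  ultimately show ?thesis by blast
qed

lemma proj_pt_eqI:
  fixes v w :: "3 \<Rightarrow> 'k::field"
  assumes "v \<noteq> (\<lambda>_. 0)" "w \<noteq> (\<lambda>_. 0)" "cross v w = (\<lambda>_. 0)"
  shows "proj_pt v = proj_pt w"
proof -
  obtain c where c: "c \<noteq> 0" "v = (\<lambda>i. c * w i)" using cross_eq_0_imp_multiple assms by blast
  have "\<exists>d. (\<lambda>i. e * w i) = (\<lambda>i. d * v i) \<and> d \<noteq> 0" if "e \<noteq> 0" for e
    using c that by (intro exI[of _ "e / c"]) simp
  moreover have "\<exists>d. (\<lambda>i. e * v i) = (\<lambda>i. d * w i) \<and> d \<noteq> 0" if "e \<noteq> 0" for e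
    using c that by (intro exI[of _ "e * c"]) (simp add: mult.assoc)
  ultimately show ?thesis unfolding proj_pt_def by blast
qed

lemma proj_pt_in_proj_line_iff:
  fixes v :: "3 \<Rightarrow> 'k::field"
  assumes "v \<noteq> (\<lambda>_. 0)" shows "proj_pt v \<in> proj_line a \<longleftrightarrow> dot a v = 0"
proof -
  have "(\<forall>w\<in>proj_pt v. dot a w = 0) \<longleftrightarrow> dot a v = 0"
    by (auto simp: proj_pt_def dot_scale intro!: exI[of _ 1] dest: spec[of _ v])
  moreover have "proj_pt v \<in> P2" using assms by (auto simp: P2_def)
  ultimately show ?thesis by (simp add: proj_line_def flip: dot_def)
qed

lemma cross_eq_0_imp_dot_eq_0_iff:
  fixes a b :: "3 \<Rightarrow> 'k::field"
  assumes "a \<noteq> (\<lambda>_. 0)" "b \<noteq> (\<lambda>_. 0)" "cross a b = (\<lambda>_. 0)"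
  shows "dot a v = 0 \<longleftrightarrow> dot b v = 0"
  using cross_eq_0_imp_multiple[OF assms] by (auto simp: dot_scale)

lemma proj_line_eqI:
  fixes a b :: "3 \<Rightarrow> 'k::field"
  assumes "a \<noteq> (\<lambda>_. 0)" "b \<noteq> (\<lambda>_. 0)" "cross a b = (\<lambda>_. 0)"
  shows "proj_line a = proj_line b"
  unfolding proj_line_def dot_def[symmetric]
  using cross_eq_0_imp_dot_eq_0_iff[OF assms] by blast

text \<open>Over a finite field the product of all linear factors, plus one, has no root.\<close>

lemma alg_closed_infinite:
  assumes "alg_closed TYPE('k::field)" shows "infinite (UNIV :: 'k set)"
proof
  assume fin: "finite (UNIV :: 'k set)"
  let ?q = "\<Prod>x\<in>(UNIV :: 'k set). [:- x, 1:]"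
  have "degree ?q = card (UNIV :: 'k set)"
    using fin by (subst degree_prod_eq_sum_degree) auto
  moreover have "card (UNIV :: 'k set) > 0" using fin by (simp add: card_gt_0_iff)
  ultimately have deg: "degree (?q + 1) \<ge> 1" by (subst degree_add_eq_left) auto
  have "poly (?q + 1) y = 1" for y
    using fin by (simp add: poly_prod prod_zero_iff[OF fin])
  then show False using assms deg unfolding alg_closed_def by (metis zero_neq_one)
qed

text \<open>Candidates are the lines \<open>(1, t, t^2)\<close>: passing through a given point is a
  nonzero polynomial condition on \<open>t\<close>, so only finitely many values are
  excluded.\<close>

lemma exists_general_line:
  fixes V :: "(3 \<Rightarrow> 'k::field) set"
  assumes "infinite (UNIV :: 'k set)" "finite V" "\<And>v. v \<in> V \<Longrightarrow> v \<noteq> (\<lambda>_. 0)"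
  shows "\<exists>l. l \<noteq> (\<lambda>_. 0) \<and> (\<forall>v\<in>V. dot l v \<noteq> 0)"
proof -
  let ?p = "\<lambda>v :: 3 \<Rightarrow> 'k. [:v 0, v 1, v 2:]"
  have "(\<Prod>v\<in>V. ?p v) \<noteq> 0" using assms(2,3) by (auto simp: fun_eq_3)
  then have "finite {t. poly (\<Prod>v\<in>V. ?p v) t = 0}" by (rule poly_roots_finite)
  then obtain t where t: "poly (\<Prod>v\<in>V. ?p v) t \<noteq> 0"
    using assms(1) ex_new_if_finite by blast
  let ?l = "\<lambda>i :: 3. if i = 0 then 1 else if i = 1 then t else t * t"
  have "dot ?l v = poly (?p v) t" for v
    by (simp add: dot_def sum_3 algebra_simps)
  then have "\<forall>v\<in>V. dot ?l v \<noteq> 0" using t assms(2) by (auto simp: poly_prod)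
  moreover have "?l \<noteq> (\<lambda>_. 0)" by (auto simp: fun_eq_3)
  ultimately show ?thesis by blast
qed

lemma card_filter_eq_sum: "finite A \<Longrightarrow> card {x \<in> A. P x} = (\<Sum>x\<in>A. if P x then 1 else 0)"
  by (simp add: sum.If_cases Int_def)

text \<open>If \<open>r v\<close> denotes the number of the lines through \<open>v\<close>, then counting incidences and pairs of lines
  gives \<open>\<Sum> (r v - 1) (r v - 2) \<le> 0\<close>, which forces all inequalities to be equalities.\<close>

lemma star_points_of_counts:
  fixes l :: "3 \<Rightarrow> 'k::field"
  assumes V: "finite V" and \<Lambda>: "finite \<Lambda>"
    and off: "\<And>v. v \<in> V \<Longrightarrow> dot l v \<noteq> 0"
    and V_distinct: "\<And>v w. v \<in> V \<Longrightarrow> w \<in> V \<Longrightarrow> v \<noteq> w \<Longrightarrow> cross v w \<noteq> (\<lambda>_. 0)"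
    and \<Lambda>_nonzero: "\<And>a. a \<in> \<Lambda> \<Longrightarrow> a \<noteq> (\<lambda>_. 0)"
    and \<Lambda>_distinct: "\<And>a b. a \<in> \<Lambda> \<Longrightarrow> b \<in> \<Lambda> \<Longrightarrow> a \<noteq> b \<Longrightarrow> cross a b \<noteq> (\<lambda>_. 0)"
    and s: "card \<Lambda> \<ge> 2"
    and card_V: "2 * card V \<le> card \<Lambda> * (card \<Lambda> + 1)"
    and on_line: "\<And>a. a \<in> \<Lambda> \<Longrightarrow> card {v \<in> V. dot a v = 0} = card \<Lambda>"
    and all_lines: "\<And>n. n \<noteq> (\<lambda>_. 0) \<Longrightarrow> card {v \<in> V. dot n v = 0} = card \<Lambda> \<Longrightarrow> \<exists>a\<in>\<Lambda>. cross n a = (\<lambda>_. 0)"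
  shows "star_points l V \<Lambda>"
proof -
  define s where "s = card \<Lambda>"
  define r where "r v = card {a \<in> \<Lambda>. dot a v = 0}" for v
  define N where "N a b = card {v \<in> V. dot a v = 0 \<and> dot b v = 0}" for a b
  have N_le: "N a b \<le> (if a = b then s else 1)" if ab: "a \<in> \<Lambda>" "b \<in> \<Lambda>" for a b
  proof (cases "a = b")
    case True
    then show ?thesis using on_line[OF ab(1)] by (simp add: N_def s_def)
  next
    case False
    have "v = w" if "v \<in> {v \<in> V. dot a v = 0 \<and> dot b v = 0}" "w \<in> {v \<in> V. dot a v = 0 \<and> dot b v = 0}" for v w
      using two_common_points_imp_same_line[of v w a b] V_distinct[of v w] \<Lambda>_distinct[OF ab False] that by blast
    then have "N a b \<le> Suc 0"
      unfolding N_def using V by (subst card_le_Suc0_iff_eq) auto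
    then show ?thesis using False by simp
  qed
  have N_sum: "(\<Sum>v\<in>{v \<in> V. dot a v = 0}. r v) = (\<Sum>b\<in>\<Lambda>. N a b)" for a
  proof -
    have "(\<Sum>v\<in>{v \<in> V. dot a v = 0}. r v) = (\<Sum>v\<in>{v \<in> V. dot a v = 0}. \<Sum>b\<in>\<Lambda>. if dot b v = 0 then 1 else 0)"
      unfolding r_def by (simp only: card_filter_eq_sum[OF \<Lambda>])
    also have "\<dots> = (\<Sum>b\<in>\<Lambda>. \<Sum>v\<in>{v \<in> V. dot a v = 0}. if dot b v = 0 then 1 else 0)"
      by (rule sum.swap)
    also have "\<dots> = (\<Sum>b\<in>\<Lambda>. card {v \<in> {v \<in> V. dot a v = 0}. dot b v = 0})"
      using V by (intro sum.cong refl card_filter_eq_sum[symmetric]) simp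
    also have "\<dots> = (\<Sum>b\<in>\<Lambda>. N a b)" by (simp add: N_def)
    finally show ?thesis .
  qed
  have incid: "(\<Sum>v\<in>V. f v * r v) = (\<Sum>a\<in>\<Lambda>. \<Sum>v\<in>{v \<in> V. dot a v = 0}. f v)" for f :: "_ \<Rightarrow> nat"
  proof -
    have "(\<Sum>v\<in>V. f v * r v) = (\<Sum>v\<in>V. \<Sum>a\<in>\<Lambda>. if dot a v = 0 then f v else 0)"
      unfolding r_def
      by (simp add: card_filter_eq_sum[OF \<Lambda>] sum_distrib_left if_distrib cong: if_cong)
    also have "\<dots> = (\<Sum>a\<in>\<Lambda>. \<Sum>v\<in>V. if dot a v = 0 then f v else 0)" by (rule sum.swap)
    also have "\<dots> = (\<Sum>a\<in>\<Lambda>. \<Sum>v\<in>{v \<in> V. dot a v = 0}. f v)"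
      using V by (simp add: sum.inter_filter)
    finally show ?thesis .
  qed
  have r1: "(\<Sum>v\<in>V. r v) = s * s"
    using incid[of "\<lambda>_. 1"] on_line by (simp add: s_def)
  have r2: "(\<Sum>v\<in>V. r v * r v) = (\<Sum>a\<in>\<Lambda>. \<Sum>b\<in>\<Lambda>. N a b)"
    using incid[of r] by (simp add: N_sum)
  have row: "(\<Sum>b\<in>\<Lambda>. if a = b then s else 1) = 2 * s - 1" if "a \<in> \<Lambda>" for a
  proof -
    have "(\<Sum>b\<in>\<Lambda> - {a}. if a = b then s else 1) = (\<Sum>b\<in>\<Lambda> - {a}. 1)" by (intro sum.cong) auto
    then show ?thesis using that \<Lambda> s by (simp add: sum.remove[OF \<Lambda> that] s_def)
  qed
  have rows: "(\<Sum>b\<in>\<Lambda>. N a b) \<le> 2 * s - 1" if "a \<in> \<Lambda>" for a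
    unfolding row[OF that, symmetric] using N_le that by (intro sum_mono) blast
  \<comment> \<open>As the sum of \<open>r^2\<close> is at most \<open>s (2 s - 1)\<close> and
    \<open>2 * card V\<close> at most \<open>s (s + 1)\<close>, the right-hand side is at most 2s^2
    - s - 3s^2 + s^2 + s = 0.\<close>
  have total: "(\<Sum>v\<in>V. (int (r v) - 1) * (int (r v) - 2)) = int (\<Sum>v\<in>V. r v * r v) - 3 * int (s * s) + 2 * int (card V)"
  proof -
    have "(\<Sum>v\<in>V. (int (r v) - 1) * (int (r v) - 2)) = (\<Sum>v\<in>V. int (r v * r v) - 3 * int (r v) + 2)"
      by (intro sum.cong refl) (simp add: algebra_simps)
    also have "\<dots> = (\<Sum>v\<in>V. int (r v * r v)) - 3 * (\<Sum>v\<in>V. int (r v)) + 2 * int (card V)"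
      by (simp add: sum.distrib sum_subtractf sum_distrib_left)
    also have "\<dots> = int (\<Sum>v\<in>V. r v * r v) - 3 * int (\<Sum>v\<in>V. r v) + 2 * int (card V)"
      by simp
    finally show ?thesis unfolding r1 .
  qed
  have nonneg: "(int (r v) - 1) * (int (r v) - 2) \<ge> 0" for v
  proof (cases "r v \<ge> 2")
    case False
    then have "r v = 0 \<or> r v = 1" by auto
    then show ?thesis by auto
  qed simp
  have sq: "int (s * (2 * s - 1)) = int s * (2 * int s - 1)"
    using assms(7) by (simp add: s_def of_nat_diff)
  have "(\<Sum>v\<in>V. r v * r v) \<le> (\<Sum>a\<in>\<Lambda>. 2 * s - 1)" unfolding r2 by (intro sum_mono rows)
  also have "\<dots> = s * (2 * s - 1)" by (simp add: s_def)
  finally have r2_le: "int (\<Sum>v\<in>V. r v * r v) \<le> int s * (2 * int s - 1)"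
    unfolding sq[symmetric] by (rule of_nat_mono)
  have V_le: "2 * int (card V) \<le> int s * (int s + 1)"
    using of_nat_mono[OF card_V, where 'a = int] by (simp add: s_def algebra_simps)
  have sum_nonneg: "(\<Sum>v\<in>V. (int (r v) - 1) * (int (r v) - 2)) \<ge> 0" by (intro sum_nonneg nonneg)
  have sum_0: "(\<Sum>v\<in>V. (int (r v) - 1) * (int (r v) - 2)) = 0"
    and r2_eq: "int (\<Sum>v\<in>V. r v * r v) = int s * (2 * int s - 1)"
    and V_eq: "2 * int (card V) = int s * (int s + 1)"
    using total sum_nonneg r2_le V_le by (simp_all add: algebra_simps)
  have r_cases: "r v = 1 \<or> r v = 2" if "v \<in> V" for v
  proof -
    have "(int (r v) - 1) * (int (r v) - 2) = 0"
      using sum_0 V that nonneg by (simp add: sum_nonneg_eq_0_iff)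
    then show ?thesis by auto
  qed
  \<comment> \<open>Equality of the totals forces equality in every row, and then in every
    entry.\<close>
  have row_eq: "(\<Sum>b\<in>\<Lambda>. N a b) = 2 * s - 1" if a: "a \<in> \<Lambda>" for a
  proof (rule ccontr)
    assume "(\<Sum>b\<in>\<Lambda>. N a b) \<noteq> 2 * s - 1"
    then have "(\<Sum>a\<in>\<Lambda>. \<Sum>b\<in>\<Lambda>. N a b) < (\<Sum>a\<in>\<Lambda>. 2 * s - 1)"
      using \<Lambda> rows a by (intro sum_strict_mono_ex1) (auto simp: order_less_le)
    also have "\<dots> = s * (2 * s - 1)" by (simp add: s_def)
    finally have "int (\<Sum>v\<in>V. r v * r v) < int s * (2 * int s - 1)"
      unfolding r2 sq[symmetric] by (simp only: of_nat_less_iff)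
    then show False using r2_eq by simp
  qed
  have N_eq: "N a b = (if a = b then s else 1)" if a: "a \<in> \<Lambda>" and b: "b \<in> \<Lambda>" for a b
  proof (rule ccontr)
    assume "N a b \<noteq> (if a = b then s else 1)"
    with N_le[OF a b] have "N a b < (if a = b then s else 1)" by (rule le_neq_implies_less)
    with \<Lambda> N_le[OF a] b have "(\<Sum>b\<in>\<Lambda>. N a b) < (\<Sum>b\<in>\<Lambda>. if a = b then s else 1)"
      by (intro sum_strict_mono_ex1 ballI bexI[of _ b])
    then show False using row_eq[OF a] row[OF a] by simp
  qed
  \<comment> \<open>Every \<open>r v\<close> is 1 or 2, so one extra unit at each simple point makes
    all summands 2.\<close>
  have card_split: "card {v \<in> A. r v = 1} + (\<Sum>v\<in>A. r v) = 2 * card A" if "A \<subseteq> V" for A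
  proof -
    have fin: "finite A" using that V finite_subset by blast
    have "card {v \<in> A. r v = 1} + (\<Sum>v\<in>A. r v) = (\<Sum>v\<in>A. (if r v = 1 then 1 else 0) + r v)"
      by (simp add: card_filter_eq_sum[OF fin] sum.distrib)
    also have "\<dots> = (\<Sum>v\<in>A. 2)" using r_cases that by (intro sum.cong) auto
    finally show ?thesis by simp
  qed
  have simple: "\<exists>!q. q \<in> V \<and> dot a q = 0 \<and> r q = 1" if a: "a \<in> \<Lambda>" for a
  proof -
    \<comment> \<open>The \<open>s\<close> points of the line have \<open>r\<close>-sum
      \<open>2 s - 1\<close>, one short of \<open>2 s\<close>.\<close>
    have "card {v \<in> {v \<in> V. dot a v = 0}. r v = 1} = 1"
      using card_split[of "{v \<in> V. dot a v = 0}"] N_sum[of a] row_eq[OF a] on_line[OF a] s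
      by (auto simp: s_def)
    then obtain q where "{v \<in> {v \<in> V. dot a v = 0}. r v = 1} = {q}" using card_1_singletonE by blast
    then have "v \<in> V \<and> dot a v = 0 \<and> r v = 1 \<longleftrightarrow> v = q" for v by blast
    then show ?thesis by simp
  qed
  have card_simple: "card {v \<in> V. r v = 1} = s"
  proof -
    have "2 * card V = s * (s + 1)" using V_eq by (simp add: algebra_simps flip: of_nat_eq_iff[where 'a = int])
    then show ?thesis using card_split[of V] by (simp add: r1)
  qed
  have r_1_unique: "a = b" if q: "r q = 1" "a \<in> \<Lambda>" "b \<in> \<Lambda>" "dot a q = 0" "dot b q = 0" for a b q
  proof -
    obtain c where "{a \<in> \<Lambda>. dot a q = 0} = {c}" using q(1) card_1_singletonE unfolding r_def by blast
    then have "x \<in> \<Lambda> \<and> dot x q = 0 \<longleftrightarrow> x = c" for x by blast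
    then show ?thesis using q by metis
  qed
  \<comment> \<open>Suppose \<open>n\<close> contains all \<open>s\<close> simple points. If these
    are all its points of \<open>V\<close>, then \<open>all_lines\<close> puts \<open>n\<close>
    among the lines of \<open>\<Lambda>\<close>; otherwise \<open>n\<close> shares a double point
    and a simple point with some line of \<open>\<Lambda>\<close> and equals it. Either way the
    simple point of another line would lie on two lines.\<close>
  have noncoll: "\<exists>q\<in>V. r q = 1 \<and> dot n q \<noteq> 0" if n: "n \<noteq> (\<lambda>_. 0)" for n
  proof (rule ccontr)
    assume "\<not> ?thesis"
    then have on: "dot n q = 0" if "q \<in> V" "r q = 1" for q using that by blast
    have "\<exists>a\<in>\<Lambda>. cross n a = (\<lambda>_. 0)"
    proof (cases "{v \<in> V. dot n v = 0} = {v \<in> V. r v = 1}")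
      case True
      then show ?thesis using all_lines[OF n] card_simple by (simp add: s_def)
    next
      case False
      then obtain v where v: "v \<in> V" "dot n v = 0" "r v \<noteq> 1" using on by blast
      have "{a \<in> \<Lambda>. dot a v = 0} \<noteq> {}"
      proof
        assume "{a \<in> \<Lambda>. dot a v = 0} = {}"
        then have "r v = 0" unfolding r_def by (simp only: card.empty)
        then show False using r_cases[OF v(1)] by simp
      qed
      then obtain a where a: "a \<in> \<Lambda>" "dot a v = 0" by blast
      obtain q where q: "q \<in> V" "dot a q = 0" "r q = 1" using simple[OF a(1)] by blast
      have "cross v q \<noteq> (\<lambda>_. 0)" using V_distinct[OF v(1) q(1)] v q by blast
      then show ?thesis using two_common_points_imp_same_line v a q on by blast
    qed
    then obtain a where a: "a \<in> \<Lambda>" "cross n a = (\<lambda>_. 0)" by blast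
    have "\<exists>b\<in>\<Lambda>. b \<noteq> a"
    proof (rule ccontr)
      assume "\<not> ?thesis"
      then have "\<Lambda> \<subseteq> {a}" by blast
      then have "card \<Lambda> \<le> 1" using card_mono[of "{a}" \<Lambda>] by simp
      then show False using s by simp
    qed
    then obtain b where b: "b \<in> \<Lambda>" "b \<noteq> a" by blast
    obtain q where q: "q \<in> V" "dot b q = 0" "r q = 1" using simple[OF b(1)] by blast
    have "dot a q = 0" using cross_eq_0_imp_dot_eq_0_iff[OF n \<Lambda>_nonzero[OF a(1)] a(2)] on[OF q(1,3)] by blast
    then show False using r_1_unique[OF q(3) a(1) b(1)] q b by blast
  qed
  have meet: "\<exists>v\<in>V. dot a v = 0 \<and> dot b v = 0" if "a \<in> \<Lambda>" "b \<in> \<Lambda>" "a \<noteq> b" for a b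
  proof -
    have "N a b = 1" using N_eq[OF that(1,2)] that(3) by simp
    then have "{v \<in> V. dot a v = 0 \<and> dot b v = 0} \<noteq> {}" unfolding N_def by (metis card.empty zero_neq_one)
    then show ?thesis by blast
  qed
  show ?thesis
    by (rule star_points.intro)
      (fact V \<Lambda> off V_distinct \<Lambda>_nonzero \<Lambda>_distinct meet r_cases[unfolded r_def]
        simple[unfolded r_def] noncoll[unfolded r_def])+
qed

section \<open>Splitting off the product of the lines\<close>

lemma homog_prod_Lin_set: "finite \<Lambda> \<Longrightarrow> homog (\<Prod>a\<in>\<Lambda>. Lin a) (card \<Lambda>)"
  by (induction \<Lambda> rule: finite_induct) (use homog_one homog_mult[OF homog_Lin] in auto)

lemma homog_prod_Lin_mult_imp:
  assumes "finite \<Lambda>" "\<And>a. a \<in> \<Lambda> \<Longrightarrow> a \<noteq> (\<lambda>_. 0)" "homog ((\<Prod>a\<in>\<Lambda>. Lin a) * G) (card \<Lambda> + d)"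
  shows "homog G d"
  using assms
proof (induction \<Lambda> rule: finite_induct)
  case (insert a \<Lambda>)
  then have "homog (Lin a * ((\<Prod>a\<in>\<Lambda>. Lin a) * G)) (Suc (card \<Lambda> + d))" by (simp add: mult.assoc)
  then have "homog ((\<Prod>a\<in>\<Lambda>. Lin a) * G) (card \<Lambda> + d)"
    using homog_Lin_mult_imp insert.prems(1) by blast
  then show ?case using insert by blast
qed simp

context star_points
begin

lemma fat_forms_eq:
  assumes on_line: "\<And>a. a \<in> \<Lambda> \<Longrightarrow> card {v \<in> V. dot a v = 0} = card \<Lambda>"
    and less: "card \<Lambda> + d < m * card \<Lambda>"
  shows "{F. homog F (card \<Lambda> + d) \<and> (\<forall>v\<in>V. F \<in> J v m)} =
    (*) (\<Prod>a\<in>\<Lambda>. Lin a) ` {G. homog G d \<and> (\<forall>v\<in>V. G \<in> J v (m - card (through v)))}"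
proof -
  let ?P = "\<Prod>a\<in>\<Lambda>. Lin a"
  have nz: "v \<noteq> (\<lambda>_. 0)" if "v \<in> V" for v using off[OF that] by (auto simp: dot_def)
  have iff: "?P * G \<in> J v m \<longleftrightarrow> G \<in> J v (m - card (through v))" if "v \<in> V" for v G
    by (rule prod_Lin_mult_in_J_iff[OF finite_\<Lambda> \<Lambda>_nonzero nz[OF that]])
  show ?thesis
  proof (intro equalityI subsetI)
    fix F assume F: "F \<in> {F. homog F (card \<Lambda> + d) \<and> (\<forall>v\<in>V. F \<in> J v m)}"
    have "Lin a dvd F" if a: "a \<in> \<Lambda>" for a
    proof -
      \<comment> \<open>A point on \<open>a\<close> and off \<open>l\<close> shows that the two
        lines are distinct, as the divisibility criterion requires.\<close>
      obtain q where "q \<in> V" "dot a q = 0" using simple[OF a] by blast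
      then have "cross a l \<noteq> (\<lambda>_. 0)" using cross_nonzero(1)[OF \<Lambda>_nonzero[OF a]] off by blast
      then show ?thesis
        by (rule Lin_dvd_of_many_points[where W = "{v \<in> V. dot a v = 0}" and m = m and t = "card \<Lambda> + d"])
          (use F finite_V off V_distinct on_line[OF a] less in auto)
    qed
    then have "?P dvd F" by (intro prod_Lin_dvd finite_\<Lambda> \<Lambda>_nonzero \<Lambda>_distinct)
    then obtain G where G: "F = ?P * G" by (auto elim: dvdE)
    have "homog G d" using homog_prod_Lin_mult_imp[OF finite_\<Lambda> \<Lambda>_nonzero, of G d] F G by simp
    then show "F \<in> (*) ?P ` {G. homog G d \<and> (\<forall>v\<in>V. G \<in> J v (m - card (through v)))}"
      using F G iff by auto
  qed (auto simp: iff intro: homog_mult[OF homog_prod_Lin_set[OF finite_\<Lambda>]])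
qed

lemma dim_fat_forms_diff:
  assumes on_line: "\<And>a. a \<in> \<Lambda> \<Longrightarrow> card {v \<in> V. dot a v = 0} = card \<Lambda>"
    and s: "card \<Lambda> \<ge> 2" and m: "m \<ge> 2" and l: "l \<noteq> (\<lambda>_. 0)"
  shows "pscale.dim {F. homog F (m * card \<Lambda> - 1) \<and> (\<forall>v\<in>V. F \<in> J v m)} =
    pscale.dim {F. homog F (m * card \<Lambda> - 2) \<and> (\<forall>v\<in>V. F \<in> J v m)} + (m - 1) * card \<Lambda>"
proof -
  let ?P = "\<Prod>a\<in>\<Lambda>. Lin a"
  have P: "?P \<noteq> 0" using \<Lambda>_nonzero finite_\<Lambda> by (auto simp: Lin_eq_0_iff)
  \<comment> \<open>The residual forms live in degrees \<open>d\<close> and \<open>Suc d\<close>,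
    the larger being \<open>(m - 1) * card \<Lambda> - 1\<close>. The bounds on \<open>s\<close> and
    \<open>m\<close> keep the subtraction from being truncated.\<close>
  define d where "d = card \<Lambda> * (m - 1) - 2"
  have "2 * 1 \<le> card \<Lambda> * (m - 1)" using s m by (intro mult_le_mono) auto
  then have d: "card \<Lambda> * (m - 1) = d + 2" by (simp add: d_def)
  moreover have "m * card \<Lambda> = card \<Lambda> * (m - 1) + card \<Lambda>" using m by (cases m) auto
  ultimately have deg: "m * card \<Lambda> - 1 = card \<Lambda> + Suc d" "m * card \<Lambda> - 2 = card \<Lambda> + d"
    "m * card \<Lambda> = card \<Lambda> + d + 2" by auto
  have "surj_mod l V (\<lambda>v. m - card (through v)) (Suc d)"
    using surj_mod_residual[OF m] d by simp
  from dim_fat_forms_Suc[OF this off l]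
  show ?thesis
    unfolding deg(1,2) mult.commute[of "m - 1"] d using deg(3)
    by (simp add: fat_forms_eq[OF on_line] dim_mult_image[OF P] del: add_Suc_right)
qed

end

section \<open>From the configuration to coordinate vectors\<close>

theorem theorem4p5:
  fixes X :: "(3 \<Rightarrow> 'k::field) set set" and s m :: nat
  assumes "alg_closed TYPE('k)"
    and "kconfig X (\<lambda>i. i) s"
    and "s \<ge> 2"
    and "card {L. is_line L \<and> card (L \<inter> X) = s} = s"
    and "m \<ge> 2"
  shows "delta_hilb_fat X m (int (m * s) - 1) = int s"
proof -
  let ?M = "{L. is_line L \<and> card (L \<inter> X) = s}"
  have X: "X \<subseteq> P2" "finite X" using assms(2) by (auto simp: kconfig_def)
  \<comment> \<open>An upper bound from the union of the \<open>Xs i\<close>; the incidence count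
    turns it into an equality.\<close>
  have card_X: "2 * card X \<le> s * (s + 1)"
  proof -
    obtain Xs where Xs: "X = (\<Union>i\<in>{1..s}. Xs i)" "\<forall>i\<in>{1..s}. card (Xs i) = i"
      using assms(2) unfolding kconfig_def by (elim conjE exE) metis
    have "card X \<le> (\<Sum>i\<in>{1..s}. card (Xs i))" unfolding Xs(1) by (rule card_UN_le) simp
    also have "\<dots> = (\<Sum>i\<in>{1..s}. i)" using Xs(2) by (intro sum.cong) auto
    finally have "card X \<le> (\<Sum>i\<in>{1..s}. i)" .
    moreover have "2 * (\<Sum>i\<in>{1..s}. i) = s * (s + 1)" by (induction s) auto
    ultimately show ?thesis by linarith
  qed
  have "\<forall>P\<in>X. \<exists>v. v \<noteq> (\<lambda>_. 0) \<and> P = proj_pt v" using X(1) by (auto simp: P2_def)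
  from bchoice[OF this] obtain \<rho> where \<rho>_all: "\<forall>P\<in>X. \<rho> P \<noteq> (\<lambda>_. 0) \<and> P = proj_pt (\<rho> P)"
    by (rule exE)
  have \<rho>_nz: "\<rho> P \<noteq> (\<lambda>_. 0)" if "P \<in> X" for P using bspec[OF \<rho>_all that] by (rule conjunct1)
  have \<rho>: "P = proj_pt (\<rho> P)" if "P \<in> X" for P using bspec[OF \<rho>_all that] by (rule conjunct2)
  have "\<forall>L\<in>?M. \<exists>a. a \<noteq> (\<lambda>_. 0) \<and> L = proj_line a" by (auto simp: is_line_def)
  from bchoice[OF this] obtain \<alpha> where \<alpha>_all: "\<forall>L\<in>?M. \<alpha> L \<noteq> (\<lambda>_. 0) \<and> L = proj_line (\<alpha> L)"
    by (rule exE)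
  have \<alpha>_nz: "\<alpha> L \<noteq> (\<lambda>_. 0)" if "L \<in> ?M" for L using bspec[OF \<alpha>_all that] by (rule conjunct1)
  have \<alpha>: "L = proj_line (\<alpha> L)" if "L \<in> ?M" for L using bspec[OF \<alpha>_all that] by (rule conjunct2)
  define V where "V = \<rho> ` X"
  define \<Lambda> where "\<Lambda> = \<alpha> ` ?M"
  have V_nz: "v \<noteq> (\<lambda>_. 0)" if "v \<in> V" for v using that \<rho>_nz by (auto simp: V_def)
  have finV: "finite V" using X by (simp add: V_def)
  have X_eq: "X = proj_pt ` V" using \<rho> by (force simp: V_def)
  have inj_V: "inj_on proj_pt V" using \<rho> by (auto simp: V_def intro!: inj_onI)
  have card_V: "card V = card X" using card_image[OF inj_V] X_eq by simp
  have "inj_on \<alpha> ?M" using \<alpha> by (metis (lifting) inj_onI)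
  then have card_\<Lambda>: "card \<Lambda> = s" unfolding \<Lambda>_def using assms(4) by (simp only: card_image)
  \<comment> \<open>An infinite set has \<open>card\<close> equal to 0, which
    \<open>s \<ge> 2\<close> excludes.\<close>
  then have fin\<Lambda>: "finite \<Lambda>" using assms(3) card.infinite by fastforce
  have count: "card {v \<in> V. dot n v = 0} = card (proj_line n \<inter> X)" for n
  proof -
    have "proj_line n \<inter> X = proj_pt ` {v \<in> V. dot n v = 0}"
      using proj_pt_in_proj_line_iff V_nz unfolding X_eq by blast
    moreover have "inj_on proj_pt {v \<in> V. dot n v = 0}" using inj_V by (rule inj_on_subset) auto
    ultimately show ?thesis by (simp add: card_image)
  qed
  obtain l where l: "l \<noteq> (\<lambda>_. 0)" "\<forall>v\<in>V. dot l v \<noteq> 0"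
    using exists_general_line[OF alg_closed_infinite[OF assms(1)] finV V_nz] by blast
  have on_line: "card {v \<in> V. dot a v = 0} = card \<Lambda>" if a: "a \<in> \<Lambda>" for a
  proof -
    obtain L where L: "L \<in> ?M" "a = \<alpha> L" using a unfolding \<Lambda>_def by blast
    then have "proj_line a = L" using \<alpha> by blast
    then show ?thesis unfolding count card_\<Lambda> using L(1) by simp
  qed
  interpret star_points l V \<Lambda>
  proof (rule star_points_of_counts[OF finV fin\<Lambda>])
    show "cross v w \<noteq> (\<lambda>_. 0)" if "v \<in> V" "w \<in> V" "v \<noteq> w" for v w
      using proj_pt_eqI[of v w] V_nz inj_V that unfolding inj_on_def by blast
    show "a \<noteq> (\<lambda>_. 0)" if "a \<in> \<Lambda>" for a
      using that unfolding \<Lambda>_def by (rule imageE) (simp only: \<alpha>_nz not_False_eq_True)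
    show "cross a b \<noteq> (\<lambda>_. 0)" if ab: "a \<in> \<Lambda>" "b \<in> \<Lambda>" "a \<noteq> b" for a b
    proof -
      obtain L L' where L: "L \<in> ?M" "a = \<alpha> L" "L' \<in> ?M" "b = \<alpha> L'" using ab unfolding \<Lambda>_def by blast
      then have "proj_line a \<noteq> proj_line b" using \<alpha>[OF L(1)] \<alpha>[OF L(3)] ab(3) by auto
      then show ?thesis
        using proj_line_eqI[of a b] \<alpha>_nz[OF L(1)] \<alpha>_nz[OF L(3)] unfolding L(2,4) by blast
    qed
    show "\<exists>a\<in>\<Lambda>. cross n a = (\<lambda>_. 0)" if n: "n \<noteq> (\<lambda>_. 0)" "card {v \<in> V. dot n v = 0} = card \<Lambda>" for n
    proof -
      have "proj_line n \<in> ?M" using n unfolding count card_\<Lambda> by (auto simp: is_line_def)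
      define a where "a = \<alpha> (proj_line n)"
      have a: "a \<in> \<Lambda>" "a \<noteq> (\<lambda>_. 0)" "proj_line a = proj_line n"
        using \<open>proj_line n \<in> ?M\<close> \<alpha>_nz \<alpha>[symmetric] unfolding a_def \<Lambda>_def by blast+
      \<comment> \<open>Two points determine the coefficient vector of a line up to scaling, so
        \<open>n\<close> is proportional to the chosen vector \<open>a\<close>.\<close>
      have "2 \<le> card {v \<in> V. dot n v = 0}" using n(2) card_\<Lambda> assms(3) by simp
      then obtain v w where vw: "v \<in> {v \<in> V. dot n v = 0}" "w \<in> {v \<in> V. dot n v = 0}" "v \<noteq> w"
        by (metis (no_types, lifting) card_le_Suc0_iff_eq card.infinite not_less_eq_eq numeral_2_eq_2 zero_le)
      have "cross v w \<noteq> (\<lambda>_. 0)"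
        using proj_pt_eqI[of v w] V_nz inj_V vw unfolding inj_on_def by blast
      moreover have "dot a v = 0" "dot a w = 0"
        using vw a(3) proj_pt_in_proj_line_iff[OF V_nz] by blast+
      ultimately have "cross n a = (\<lambda>_. 0)"
        using two_common_points_imp_same_line vw by blast
      then show ?thesis using a(1) by blast
    qed
  qed (use l assms(3) card_X card_V card_\<Lambda> on_line in auto)
  have fat: "deg_part (fat_ideal X m) t = {F. homog F t \<and> (\<forall>v\<in>V. F \<in> J v m)}" for t
    unfolding deg_part_def fat_ideal_def X_eq by auto
  have forms: "deg_part UNIV t = forms t" for t
    by (auto simp: deg_part_def forms_def)
  have ms: "N - 1 = Suc (N - 2)" "\<not> int N - 1 < 0" "\<not> int N - 2 < 0"
    "nat (int N - 1) = N - 1" "nat (int N - 2) = N - 2" "int N - 1 - 1 = int N - 2"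
    if "2 * 2 \<le> N" for N :: nat
    using that by auto
  have "2 * 2 \<le> m * s" using assms by (intro mult_le_mono)
  note ms = ms[OF this]
  have mul: "int ((m - 1) * s) = int (m * s) - int s"
    using assms(5) by (simp add: of_nat_diff algebra_simps)
  have "delta_hilb_fat X m (int (m * s) - 1) =
     (int (pscale.dim (forms (m * s - 1) :: 'k mpoly3 set)) - int (pscale.dim (deg_part (fat_ideal X m) (m * s - 1)))) -
     (int (pscale.dim (forms (m * s - 2) :: 'k mpoly3 set)) - int (pscale.dim (deg_part (fat_ideal X m) (m * s - 2))))"
    unfolding delta_hilb_fat_def hilb_fat_def forms ms(6) by (simp only: ms(2-5) if_False)
  also have "\<dots> = int (m * s) - int ((m - 1) * s)"
    using dim_fat_forms_diff[OF on_line _ assms(5) l(1)] card_\<Lambda> assms(3) ms(1)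
      card_monomials_Suc[of "m * s - 2"]
    by (simp add: fat dim_forms)
  finally show ?thesis unfolding mul by simp
qed

end
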